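(* Let $L>0$, let $f\in PW_L$, and let $a\in\mathbb{C}$ be such that $\operatorname{Im}a>0$ and $f(a)\neq 0$. Let $0<\lambda<\operatorname{Im}a$. Then the operator $\mathfrak{F}_a:PW_L\to H^2_\tau(\mathcal{S}_\lambda)$ is bounded, with $$\|\mathfrak{F}_af\|_{H^2_\tau(\mathcal{S}_\lambda)}<\left[1+\frac{2\operatorname{Im}a}{\operatorname{Im}a-\lambda}\right]e^{\frac{2(\operatorname{Im}a)^2}{|a|^2}}\,e^{L\lambda}\,\|f\|_2.$$ In particular, $\widehat{\mathfrak{F}_af}\in L^2(\mathbb{R},e^{2\lambda|x|}\,dx)$.
   Context: $\|\cdot\|_2$ is the norm of $L^2(\mathbb{R})$ (complex-valued functions). The Fourier transform is normalized by $\widehat f(w)=\frac{1}{\sqrt{2\pi}}\int_{\mathbb{R}}f(x)e^{-iwx}\,dx$, extended unitarily to $L^2(\mathbb{R})$. For $L>0$, $PW_L$ (Paley-Wiener class) is the space of $f\in L^2(\mathbb{R})$ with $\operatorname{supp}\widehat f\subseteq[-L,L]$; each $f\in PW_L$ is identified with its extension to an entire function, and $f(a)$ denotes the value of this extension at $a$. For $a\in\mathbb{C}$ with $\operatorname{Im}a>0$, the flipping operator is $$(\mathfrak{F}_af)(x)=\frac{1-x/\bar a}{1-x/a}\cdot\frac{e^{x/\bar a}}{e^{x/a}}\,f(x),\qquad x\in\mathbb{R}.$$ The function $\mathfrak{F}_af$ is identified with its meromorphic extension given by the same formula with $x$ replaced by $z\in\mathbb{C}$. For $\lambda>0$, $\mathcal{S}_\lambda=\{z\in\mathbb{C}:|\operatorname{Im}z|<\lambda\}$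 and $H^2_\tau(\mathcal{S}_\lambda)$ is the space of holomorphic functions $g$ on $\mathcal{S}_\lambda$ such that $$\|g\|^2_{H^2_\tau(\mathcal{S}_\lambda)}=\sup_{|y|<\lambda}\int_{\mathbb{R}}|g(x+iy)|^2\,dx<+\infty.$$ $L^2(\mathbb{R},e^{2\lambda|x|}\,dx)$ is the space of measurable $F$ on $\mathbb{R}$ with $\int_{\mathbb{R}}|F(x)|^2e^{2\lambda|x|}\,dx<+\infty$. *)

theory Defs
  imports "HOL-Complex_Analysis.Complex_Analysis"
begin

section \<open>The space \<open>L\<^sup>2(\<real>)\<close> and the Fourier transform\<close>

text \<open>Elements of \<open>L\<^sup>2(\<real>)\<close> are represented by Borel functions; all notions below that are
  applied to them depend only on the class modulo almost everywhere equality.\<close>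

definition L2 :: "(real \<Rightarrow> complex) set" where
  "L2 = {f \<in> borel_measurable lborel. integrable lborel (\<lambda>x. (cmod (f x))\<^sup>2)}"

definition L2_norm :: "(real \<Rightarrow> complex) \<Rightarrow> real" where
  "L2_norm f = sqrt (LINT x|lborel. (cmod (f x))\<^sup>2)"

text \<open>\<open>L\<^sup>2(\<real>, e\<^bsup>2\<lambda>|x|\<^esup> dx)\<close>\<close>

definition L2_weighted :: "real \<Rightarrow> (real \<Rightarrow> complex) set" where
  "L2_weighted lam =
     {F \<in> borel_measurable lborel.
        (\<integral>\<^sup>+ x. ennreal ((cmod (F x))\<^sup>2 * exp (2 * lam * \<bar>x\<bar>)) \<partial>lborel) < \<infinity>}"

text \<open>The integral below is the Fourier transform only for integrable \<open>f\<close>.\<close>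

definition fourier_L1 :: "(real \<Rightarrow> complex) \<Rightarrow> real \<Rightarrow> complex" where
  "fourier_L1 f w =
     1 / complex_of_real (sqrt (2 * pi)) *
       (LINT x|lborel. f x * exp (- (\<i> * complex_of_real w * complex_of_real x)))"

text \<open>The extension to \<open>L\<^sup>2\<close> is by continuity from \<open>L\<^sup>1 \<inter> L\<^sup>2\<close>. The requirement
  \<open>fourier_L1 (s n) \<in> L2\<close> is automatic by Plancherel's theorem; it is there because
  the Bochner integral in \<^const>\<open>L2_norm\<close> is \<open>0\<close> for non-integrable arguments.\<close>

definition has_L2_fourier :: "(real \<Rightarrow> complex) \<Rightarrow> (real \<Rightarrow> complex) \<Rightarrow> bool" where
  "has_L2_fourier f F \<longleftrightarrow>
     f \<in> L2 \<and> F \<in> L2 \<and>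
     (\<exists>s :: nat \<Rightarrow> real \<Rightarrow> complex.
        (\<forall>n. integrable lborel (s n) \<and> s n \<in> L2 \<and> fourier_L1 (s n) \<in> L2) \<and>
        (\<lambda>n. L2_norm (\<lambda>x. s n x - f x)) \<longlonglongrightarrow> 0 \<and>
        (\<lambda>n. L2_norm (\<lambda>w. fourier_L1 (s n) w - F w)) \<longlonglongrightarrow> 0)"

text \<open>For \<open>f \<in> L2\<close> such an \<open>F\<close> exists and is unique almost everywhere
  (Plancherel and completeness of \<open>L\<^sup>2\<close>), so the choice only selects a representative.\<close>

definition fourier_L2 :: "(real \<Rightarrow> complex) \<Rightarrow> real \<Rightarrow> complex" where
  "fourier_L2 f = (SOME F. has_L2_fourier f F)"

text \<open>Support of a class modulo almost everywhere equality: the complement of the largest open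
  set on which the function vanishes almost everywhere.\<close>

definition ess_supp :: "(real \<Rightarrow> complex) \<Rightarrow> real set" where
  "ess_supp F = - \<Union>{U. open U \<and> (AE x in lborel. x \<in> U \<longrightarrow> F x = 0)}"

section \<open>Paley--Wiener space, Hardy space of the strip, flipping operator\<close>

definition on_reals :: "(complex \<Rightarrow> complex) \<Rightarrow> real \<Rightarrow> complex" where
  "on_reals g = (\<lambda>x. g (complex_of_real x))"

text \<open>Each function of the Paley--Wiener space is identified with its entire extension, so the
  elements are the entire functions whose restriction to the real line is in \<open>L\<^sup>2\<close> with
  Fourier transform supported in \<open>[-L, L]\<close>.\<close>

definition PW :: "real \<Rightarrow> (complex \<Rightarrow> complex) set" where
  "PW L = {f. f holomorphic_on UNIV \<and> on_reals f \<in> L2 \<and>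
              ess_supp (fourier_L2 (on_reals f)) \<subseteq> {-L..L}}"

definition PW_norm :: "(complex \<Rightarrow> complex) \<Rightarrow> real" where
  "PW_norm f = L2_norm (on_reals f)"

definition strip :: "real \<Rightarrow> complex set" where
  "strip lam = {z. \<bar>Im z\<bar> < lam}"

definition H2_strip_sqnorm :: "real \<Rightarrow> (complex \<Rightarrow> complex) \<Rightarrow> ennreal" where
  "H2_strip_sqnorm lam g =
     (SUP y\<in>{-lam<..<lam}. \<integral>\<^sup>+ x. ennreal ((cmod (g (Complex x y)))\<^sup>2) \<partial>lborel)"

text \<open>Only the values on the strip matter for membership and for the norm.\<close>

definition H2_strip :: "real \<Rightarrow> (complex \<Rightarrow> complex) set" where
  "H2_strip lam = {g. g holomorphic_on strip lam \<and> H2_strip_sqnorm lam g < \<infinity>}"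

definition H2_strip_norm :: "real \<Rightarrow> (complex \<Rightarrow> complex) \<Rightarrow> real" where
  "H2_strip_norm lam g = sqrt (enn2real (H2_strip_sqnorm lam g))"

text \<open>The meromorphic extension of the flipped function; its only possible pole is \<open>a\<close>, where
  the expression takes the irrelevant value \<open>0\<close>.\<close>

definition flip_op :: "complex \<Rightarrow> (complex \<Rightarrow> complex) \<Rightarrow> complex \<Rightarrow> complex" where
  "flip_op a f = (\<lambda>z. (1 - z / cnj a) / (1 - z / a) * (exp (z / cnj a) / exp (z / a)) * f z)"

text \<open>Boundedness of a linear operator \<open>T\<close> between normed function spaces given by carriers
  \<open>V\<close>, \<open>W\<close> and norms \<open>nV\<close>, \<open>nW\<close>.\<close>

definition bounded_operator ::
  "(complex \<Rightarrow> complex) set \<Rightarrow> ((complex \<Rightarrow> complex) \<Rightarrow> real) \<Rightarrow>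
   (complex \<Rightarrow> complex) set \<Rightarrow> ((complex \<Rightarrow> complex) \<Rightarrow> real) \<Rightarrow>
   ((complex \<Rightarrow> complex) \<Rightarrow> complex \<Rightarrow> complex) \<Rightarrow> bool" where
  "bounded_operator V nV W nW T \<longleftrightarrow>
     (\<forall>g\<in>V. T g \<in> W) \<and>
     (\<forall>g\<in>V. \<forall>h\<in>V. \<forall>\<alpha> \<beta>.
        T (\<lambda>z. \<alpha> * g z + \<beta> * h z) = (\<lambda>z. \<alpha> * T g z + \<beta> * T h z)) \<and>
     (\<exists>C. \<forall>g\<in>V. nW (T g) \<le> C * nV g)"

end

theory Submission
  imports Defs "HOL-Probability.Levy" "HOL-Real_Asymp.Real_Asymp"
begin

text \<open>On the strip the flipping factor is bounded pointwise, so the norm estimate reduces to the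
  Plancherel--Polya inequality \<open>\<integral> |f(x + iy)|\<^sup>2 dx \<le> e\<^bsup>2L|y|\<^esup> \<integral> |f(x)|\<^sup>2 dx\<close>. This follows from the representation
  of \<open>f\<close> as the inverse transform of \<open>G \<in> L\<^sup>2\<close> supported in \<open>[-L, L]\<close>, because passing to the line at
  height \<open>y\<close> multiplies \<open>G(w)\<close> by \<open>e\<^bsup>-wy\<^esup>\<close>. The inequality is strict since \<open>lam < Im a\<close> in the exponential
  factor and \<open>f \<noteq> 0\<close>. Only the contraction half of Plancherel's theorem is needed; equalities
  between transforms are obtained by testing against complex Gaussians and using the injectivity of the
  Fourier transform on \<open>L\<^sup>1\<close>. For the weighted integrability, moving the contour shows that the transform
  of the flipped function, multiplied by \<open>e\<^bsup>-wy\<^esup>\<close>, is the transform of its restriction to the line at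
  height \<open>y\<close>, hence square integrable for \<open>y = lam\<close> and \<open>y = -lam\<close>.\<close>

section \<open>Injectivity of the Fourier transform on \<open>L\<^sup>1\<close>\<close>

text \<open>The obstacle is that \<open>fourier_L2\<close> is a choice among limits in the mean: it
  has no pointwise formula, and identities between transforms can only hold almost everywhere.
  Gaussians exp(-w^2/2 - i z w) with complex z are suited as test functions because, up to
  constants, the family is closed under every operation that occurs: the Fourier transform,
  multiplication by characters, and multiplication by \<open>exp (- w * y)\<close>. Hence the
  exponential weight belonging to a horizontal line, which could destroy integrability of a
  transform, is absorbed into the test function and every pairing remains one of two L^2 functions.
  A test with one fixed Gaussian and all characters is the vanishing of the Fourier transform of an
  integrable function, which is where injectivity on L^1 enters. The lines at height lam and -lam
  bound the strip of the theorem, so the contour is moved inside a slightly wider strip that still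
  stays below the pole at \<open>a\<close>.\<close>

lemma borel_measurable_cnj [measurable (raw)]:
  "f \<in> borel_measurable M \<Longrightarrow> (\<lambda>x. cnj (f x)) \<in> borel_measurable M"
  by (rule borel_measurable_continuous_on[of cnj]) (intro continuous_intros)

text \<open>Frequency 0 gives the positive and negative parts of \<open>h\<close> the same mass.
  After normalisation they are probability densities with equal characteristic functions, so Levy's
  uniqueness theorem identifies them.\<close>

lemma L1_fourier_unique_real:
  fixes h :: "real \<Rightarrow> real"
  assumes h: "integrable lborel h"
    and zero: "\<And>t. (CLINT x|lborel. iexp (t * x) * h x) = 0"
  shows "AE x in lborel. h x = 0"
proof -
  have [measurable]: "h \<in> borel_measurable borel" using h by auto
  define p n where "p = (\<lambda>x. max 0 (h x))" and "n = (\<lambda>x. max 0 (- h x))"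
  have hpn: "h x = p x - n x" for x by (auto simp: p_def n_def)
  have p0: "0 \<le> p x" "0 \<le> n x" for x by (auto simp: p_def n_def)
  have int: "integrable lborel p" "integrable lborel n"
    unfolding p_def n_def using h by auto
  have [measurable]: "p \<in> borel_measurable borel" "n \<in> borel_measurable borel"
    unfolding p_def n_def by measurable
  have bp: "integrable lborel (\<lambda>x. iexp (t * x) * p x)" "integrable lborel (\<lambda>x. iexp (t * x) * n x)" for t
    by (rule Bochner_Integration.integrable_bound[OF int(1)]; simp add: norm_mult)
       (rule Bochner_Integration.integrable_bound[OF int(2)]; simp add: norm_mult)
  have eq: "(CLINT x|lborel. iexp (t * x) * p x) = (CLINT x|lborel. iexp (t * x) * n x)" for t
  proof -
    have "0 = (CLINT x|lborel. iexp (t * x) * p x - iexp (t * x) * n x)"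
      using zero[of t] by (simp add: hpn algebra_simps)
    also have "\<dots> = (CLINT x|lborel. iexp (t * x) * p x) - (CLINT x|lborel. iexp (t * x) * n x)"
      by (rule Bochner_Integration.integral_diff) (rule bp)+
    finally show ?thesis by simp
  qed
  define m where "m = integral\<^sup>L lborel p"
  have mn: "integral\<^sup>L lborel n = m"
    using eq[of 0] by (simp add: m_def)
  have m0: "0 \<le> m" unfolding m_def by (rule integral_nonneg_AE) (simp add: p0)
  show ?thesis
  \<comment> \<open>With mass 0 no normalisation is possible, but then both parts vanish almost
    everywhere.\<close>
  proof (cases "m = 0")
    case True
    then have "AE x in lborel. p x = 0" "AE x in lborel. n x = 0"
      using integral_nonneg_eq_0_iff_AE[OF int(1)] integral_nonneg_eq_0_iff_AE[OF int(2)] mn p0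
      by (auto simp: m_def)
    then show ?thesis by eventually_elim (simp add: hpn)
  next
    case False
    with m0 have m: "m > 0" by simp
    have dist: "real_distribution (density lborel (\<lambda>x. ennreal (q x / m)))"
      and char: "char (density lborel (\<lambda>x. ennreal (q x / m))) t = (CLINT x|lborel. iexp (t * x) * q x) / m"
      if q[measurable]: "q \<in> borel_measurable borel" and q0: "\<And>x. 0 \<le> q x"
        and iq: "integrable lborel q" and qm: "integral\<^sup>L lborel q = m" for q t
    proof -
      have "emeasure (density lborel (\<lambda>x. ennreal (q x / m))) UNIV = (\<integral>\<^sup>+x. ennreal (q x / m) \<partial>lborel)"
        by (subst emeasure_density) auto
      also have "\<dots> = ennreal (\<integral>x. q x / m \<partial>lborel)"
        using iq q0 m by (intro nn_integral_eq_integral) auto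
      also have "\<dots> = 1" using qm m by simp
      finally have "prob_space (density lborel (\<lambda>x. ennreal (q x / m)))"
        by (intro prob_spaceI) simp
      then show "real_distribution (density lborel (\<lambda>x. ennreal (q x / m)))"
        by (intro real_distribution.intro real_distribution_axioms.intro) auto
      have "char (density lborel (\<lambda>x. ennreal (q x / m))) t
          = (CLINT x|lborel. (q x / m) *\<^sub>R iexp (t * x))"
        unfolding char_def using q0 m by (intro integral_density) auto
      also have "\<dots> = (CLINT x|lborel. iexp (t * x) * q x / m)"
        by (intro Bochner_Integration.integral_cong) (auto simp: scaleR_conv_of_real)
      finally show "char (density lborel (\<lambda>x. ennreal (q x / m))) t = (CLINT x|lborel. iexp (t * x) * q x) / m"
        by simp
    qed
    have "density lborel (\<lambda>x. ennreal (p x / m)) = density lborel (\<lambda>x. ennreal (n x / m))"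
      by (rule Levy_uniqueness; (intro dist ext)?)
         (simp_all add: p0 int m_def[symmetric] mn char eq[simplified])
    then have "AE x in lborel. ennreal (p x / m) = ennreal (n x / m)"
      by (subst (asm) sigma_finite_measure.density_unique_iff[OF sigma_finite_lborel]) auto
    then show ?thesis
      by eventually_elim (use m p0 in \<open>simp add: hpn\<close>)
  qed
qed

text \<open>Conjugation turns the frequency \<open>t\<close> into \<open>- t\<close>, so the
  transform of \<open>cnj h\<close> vanishes as well, and with it those of the real and imaginary
  parts.\<close>

lemma L1_fourier_unique:
  fixes h :: "real \<Rightarrow> complex"
  assumes h: "integrable lborel h"
    and zero: "\<And>t. (CLINT x|lborel. h x * iexp (t * x)) = 0"
  shows "AE x in lborel. h x = 0"
proof -
  have [measurable]: "h \<in> borel_measurable borel" using h by auto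
  have int: "integrable lborel (\<lambda>x. h x * iexp (t * x))" for t
    by (rule Bochner_Integration.integrable_bound[OF h]) (auto simp: norm_mult)
  have intc: "integrable lborel (\<lambda>x. cnj (h x) * iexp (t * x))" for t
    by (rule Bochner_Integration.integrable_bound[OF h]) (auto simp: norm_mult)
  have zc: "(CLINT x|lborel. cnj (h x) * iexp (t * x)) = 0" for t
  proof -
    have "(CLINT x|lborel. cnj (h x) * iexp (t * x)) = (CLINT x|lborel. cnj (h x * iexp ((- t) * x)))"
      by (intro Bochner_Integration.integral_cong) (auto simp: exp_cnj)
    also have "\<dots> = cnj (CLINT x|lborel. h x * iexp ((- t) * x))"
      by (rule Bochner_Integration.integral_cnj)
    finally show ?thesis using zero[of "- t"] by simp
  qed
  have "AE x in lborel. Re (h x) = 0"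
  proof (rule L1_fourier_unique_real)
    fix t
    have "(CLINT x|lborel. iexp (t * x) * Re (h x)) =
        (CLINT x|lborel. (h x * iexp (t * x) + cnj (h x) * iexp (t * x)) / 2)"
      by (intro Bochner_Integration.integral_cong refl)
         (simp add: complex_add_cnj flip: distrib_right)
    also have "\<dots> = 0"
      using zero[of t] zc[of t] int intc by simp
    finally show "(CLINT x|lborel. iexp (t * x) * Re (h x)) = 0" .
  qed (use h in auto)
  moreover have "AE x in lborel. Im (h x) = 0"
  proof (rule L1_fourier_unique_real)
    fix t
    have e: "complex_of_real (Im (h x)) = (h x - cnj (h x)) / (2 * \<i>)" for x
      by (simp add: complex_diff_cnj mult.left_commute[of \<i>])
    have "(CLINT x|lborel. iexp (t * x) * Im (h x)) =
        (CLINT x|lborel. (h x * iexp (t * x) - cnj (h x) * iexp (t * x)) / (2 * \<i>))"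
      unfolding e by (intro Bochner_Integration.integral_cong refl) (simp add: field_simps)
    also have "\<dots> = 0"
      using zero[of t] zc[of t] int intc by simp
    finally show "(CLINT x|lborel. iexp (t * x) * Im (h x)) = 0" .
  qed (use h in auto)
  ultimately show ?thesis by eventually_elim (simp add: complex_eq_iff)
qed

text \<open>The multiplication formula as an instance of Fubini, with \<open>h x * g w\<close> as
  dominating product. The kernel is left general because exponentials of both signs are
  inserted.\<close>

lemma integral_kernel_swap:
  fixes h g :: "real \<Rightarrow> complex" and k :: "real \<Rightarrow> real \<Rightarrow> complex"
  assumes h: "integrable lborel h" and g: "integrable lborel g"
    and k[measurable]: "case_prod k \<in> borel_measurable (borel \<Otimes>\<^sub>M borel)"
    and k1: "\<And>x w. cmod (k x w) \<le> 1"
  shows "(LINT w|lborel. (LINT x|lborel. h x * k x w) * g w) = (LINT x|lborel. h x * (LINT w|lborel. g w * k x w))"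
proof -
  have [measurable]: "h \<in> borel_measurable borel" "g \<in> borel_measurable borel" using h g by auto
  have "integrable (lborel \<Otimes>\<^sub>M lborel) (\<lambda>(x, w). h x * g w)"
    by (rule lborel_pair.Fubini_integrable) (use h g in \<open>auto simp: norm_mult\<close>)
  then have int: "integrable (lborel \<Otimes>\<^sub>M lborel) (\<lambda>(x, w). h x * k x w * g w)"
  proof (rule Bochner_Integration.integrable_bound)
    show "AE p in lborel \<Otimes>\<^sub>M lborel. norm (case p of (x, w) \<Rightarrow> h x * k x w * g w) \<le> norm (case p of (x, w) \<Rightarrow> h x * g w)"
    proof (rule AE_I2, clarify)
      fix x w
      have "cmod (h x) * cmod (g w) * cmod (k x w) \<le> cmod (h x) * cmod (g w) * 1"
        by (intro mult_left_mono k1) simp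
      then show "cmod (h x * k x w * g w) \<le> cmod (h x * g w)" by (simp add: norm_mult mult_ac)
    qed
  qed measurable
  have "(LINT w|lborel. (LINT x|lborel. h x * k x w) * g w) = (LINT w|lborel. (LINT x|lborel. h x * k x w * g w))"
    by simp
  also have "\<dots> = (LINT x|lborel. (LINT w|lborel. h x * k x w * g w))"
    using lborel_pair.Fubini_integral[OF int] by simp
  also have "\<dots> = (LINT x|lborel. h x * (LINT w|lborel. g w * k x w))"
    by (simp add: mult_ac flip: integral_mult_right_zero)
  finally show ?thesis .
qed

section \<open>Gaussians and the contraction property\<close>

text \<open>The real part of \<open>z\<close> acts as a frequency and the imaginary part as a weight
  \<open>exp (Im z * w)\<close>, so a character or a real exponential factor only changes the
  parameter.\<close>

definition gaussian_wave :: "complex \<Rightarrow> real \<Rightarrow> complex" where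
  "gaussian_wave z w = exp (- (complex_of_real w)\<^sup>2 / 2 - \<i> * z * complex_of_real w)"

lemma borel_measurable_gaussian_wave [measurable]: "gaussian_wave z \<in> borel_measurable borel"
  unfolding gaussian_wave_def by measurable

lemma norm_gaussian_wave: "cmod (gaussian_wave z w) = exp ((Im z)\<^sup>2 / 2) * sqrt (2 * pi) * normal_density (Im z) 1 w"
  by (simp add: gaussian_wave_def normal_density_def power2_eq_square field_simps flip: exp_add)

lemma integrable_gaussian_wave: "integrable lborel (gaussian_wave z)"
  by (rule Bochner_Integration.integrable_bound[where f="\<lambda>w. exp ((Im z)\<^sup>2 / 2) * sqrt (2 * pi) * normal_density (Im z) 1 w"])
     (auto simp: norm_gaussian_wave)

lemma integral_std_gaussian_wave: "(LINT w|lborel. gaussian_wave (complex_of_real t) w) = sqrt (2 * pi) * exp (- t\<^sup>2 / 2)"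
proof -
  have "complex_of_real (exp (- ((-t)\<^sup>2) / 2)) = char std_normal_distribution (-t)"
    by (simp add: char_std_normal_distribution)
  also have "\<dots> = (LINT x|lborel. std_normal_density x *\<^sub>R iexp (-t * x))"
    unfolding char_def by (intro integral_density) auto
  also have "\<dots> = (LINT x|lborel. gaussian_wave (complex_of_real t) x / sqrt (2 * pi))"
  proof (intro Bochner_Integration.integral_cong refl)
    fix x
    have "gaussian_wave (complex_of_real t) x = complex_of_real (exp (- x\<^sup>2 / 2)) * iexp (- t * x)"
      unfolding gaussian_wave_def exp_of_real[symmetric] mult_exp_exp
      by (rule arg_cong[of _ _ exp]) simp
    then show "std_normal_density x *\<^sub>R iexp (- t * x) = gaussian_wave (complex_of_real t) x / sqrt (2 * pi)"
      by (simp add: std_normal_density_def scaleR_conv_of_real)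
  qed
  also have "\<dots> = (LINT x|lborel. gaussian_wave (complex_of_real t) x) / sqrt (2 * pi)"
    by simp
  finally show ?thesis by (simp add: field_simps)
qed

text \<open>The real translation by \<open>Im z\<close> cancels the real linear term of the
  exponent. This reduces complex \<open>z\<close> to the characteristic function of the normal law
  without moving a contour.\<close>

lemma integral_gaussian_wave:
  fixes z :: complex
  shows "(LINT w|lborel. gaussian_wave z w) = sqrt (2 * pi) * exp (- z\<^sup>2 / 2)"
proof -
  obtain q p where z: "z = Complex q p" by (cases z)
  have zz: "z = complex_of_real q + \<i> * complex_of_real p" by (simp add: z complex_eq_iff)
  have sh: "gaussian_wave z (p + 1 * w) = gaussian_wave (complex_of_real q) w * exp ((complex_of_real p)\<^sup>2 / 2 - \<i> * q * p)" for w
    unfolding gaussian_wave_def zz mult_exp_exp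
    by (rule arg_cong[of _ _ exp]) (simp add: field_simps power2_eq_square)
  have "(LINT w|lborel. gaussian_wave z w) = (LINT w|lborel. gaussian_wave z (p + 1 * w))"
    by (subst lborel_integral_real_affine[where c=1 and t=p]) auto
  also have "\<dots> = (LINT w|lborel. gaussian_wave (complex_of_real q) w) * exp ((complex_of_real p)\<^sup>2 / 2 - \<i> * q * p)"
    unfolding sh by simp
  also have "\<dots> = sqrt (2 * pi) * (exp (- (complex_of_real q)\<^sup>2 / 2) * exp ((complex_of_real p)\<^sup>2 / 2 - \<i> * q * p))"
    unfolding integral_std_gaussian_wave by (simp add: exp_of_real[symmetric])
  also have "exp (- (complex_of_real q)\<^sup>2 / 2) * exp ((complex_of_real p)\<^sup>2 / 2 - \<i> * q * p) = exp (- z\<^sup>2 / 2)"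
    unfolding zz mult_exp_exp by (rule arg_cong[of _ _ exp]) (simp add: field_simps power2_eq_square)
  finally show ?thesis .
qed

text \<open>Substituting \<open>v = d * w\<close> turns the damping factor into a standard Gaussian.
  The resulting normal density has mass 1 whatever \<open>d\<close> is, which later makes the
  estimate uniform in \<open>d\<close>.\<close>

lemma integral_scaled_gaussian:
  assumes d: "d > 0"
  shows "(LINT w|lborel. exp (- (complex_of_real (d * w))\<^sup>2 / 2) * exp (- (\<i> * complex_of_real u * complex_of_real w)))
    = complex_of_real (2 * pi * normal_density 0 d u)"
proof -
  have "(LINT v|lborel. gaussian_wave (complex_of_real (u / d)) v) = \<bar>d\<bar> *\<^sub>R (LINT w|lborel. gaussian_wave (complex_of_real (u / d)) (0 + d * w))"
    using d by (intro lborel_integral_real_affine) auto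
  also have "\<dots> = d * (LINT w|lborel. exp (- (complex_of_real (d * w))\<^sup>2 / 2) * exp (- (\<i> * complex_of_real u * complex_of_real w)))"
    using d by (auto simp: scaleR_conv_of_real gaussian_wave_def mult_exp_exp intro!: Bochner_Integration.integral_cong arg_cong[of _ _ exp])
  finally have "(LINT w|lborel. exp (- (complex_of_real (d * w))\<^sup>2 / 2) * exp (- (\<i> * complex_of_real u * complex_of_real w)))
     = complex_of_real (sqrt (2 * pi) * exp (- (u / d)\<^sup>2 / 2) / d)"
    unfolding integral_std_gaussian_wave using d by (simp add: field_simps)
  also have "sqrt (2 * pi) * exp (- (u / d)\<^sup>2 / 2) / d = 2 * pi * normal_density 0 d u"
  proof -
    define r where "r = sqrt (2 * pi)"
    have r: "r > 0" "2 * pi = r * r" by (simp_all add: r_def)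
    have "sqrt (2 * pi * d\<^sup>2) = r * d"
      using d by (simp add: real_sqrt_mult r_def)
    then have "2 * pi * normal_density 0 d u = (r * r) * (1 / (r * d) * exp (- (u / d)\<^sup>2 / 2))"
      unfolding normal_density_def r(2)[symmetric] by (simp add: power_divide mult.commute)
    then show ?thesis
      unfolding r_def[symmetric] using d r(1) by (simp add: field_simps)
  qed
  finally show ?thesis .
qed

lemma integrable_scaled_gaussian: "d > 0 \<Longrightarrow> integrable lborel (\<lambda>w::real. exp (- (d * w)\<^sup>2 / 2))"
proof -
  assume d: "d > 0"
  have eq: "exp (- (d * w)\<^sup>2 / 2) = sqrt (2 * pi / d\<^sup>2) * normal_density 0 (1 / d) w" for w
    using d by (simp add: normal_density_def power_divide power_mult_distrib real_sqrt_divide field_simps)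
  show ?thesis unfolding eq using d by (intro integrable_mult_right integrable_normal_density) simp
qed

text \<open>The squared norm with values in \<open>ennreal\<close>: it is infinite for functions
  outside \<open>L2\<close>, where \<open>L2_norm\<close> would return 0, and estimates can be
  chained without integrability conditions.\<close>

definition sqint :: "(real \<Rightarrow> complex) \<Rightarrow> ennreal" where
  "sqint f = (\<integral>\<^sup>+ x. ennreal ((cmod (f x))\<^sup>2) \<partial>lborel)"

lemma nn_integral_normal_density: "s > 0 \<Longrightarrow> (\<integral>\<^sup>+ x. ennreal (normal_density m s x) \<partial>lborel) = 1"
  by (subst nn_integral_eq_integral) auto

lemma nn_integral_cmult_normal_density:
  assumes "s > 0" "c \<ge> 0"
  shows "(\<integral>\<^sup>+ x. ennreal (c * normal_density m s x) \<partial>lborel) = ennreal c"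
  using assms by (simp add: ennreal_mult nn_integral_cmult nn_integral_normal_density)

text \<open>A Bochner integral that does not exist is 0 by convention, so the bound survives there.
  This avoids proving integrability of the inner convolutions below.\<close>

lemma integral_norm_bound_ennreal_any:
  fixes f :: "'a \<Rightarrow> 'b::{banach, second_countable_topology}"
  shows "ennreal (norm (integral\<^sup>L M f)) \<le> (\<integral>\<^sup>+ x. ennreal (norm (f x)) \<partial>M)"
  by (cases "integrable M f") (auto simp: integral_norm_bound_ennreal not_integrable_integral_eq)

text \<open>Bound the product by half the sum of the squares. In each of the two terms the variable
  missing from the square is integrated out, and the density has mass 1 in either variable.\<close>

lemma schur_normal_density:
  assumes [measurable]: "f \<in> borel_measurable borel" and s: "s > 0"
  shows "(\<integral>\<^sup>+ x. \<integral>\<^sup>+ u. ennreal (cmod (f x) * cmod (f u) * normal_density 0 s (u - x)) \<partial>lborel \<partial>lborel) \<le> sqint f"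
proof -
  have sh: "normal_density 0 s (u - x) = normal_density x s u" "normal_density 0 s (u - x) = normal_density u s x" for u x
    by (simp_all add: normal_density_def power2_commute)
  have m[measurable]: "(\<lambda>(x, u). normal_density 0 s (u - x)) \<in> borel_measurable (borel \<Otimes>\<^sub>M borel)"
    by measurable
  let ?a = "\<lambda>x u. ennreal ((cmod (f x))\<^sup>2 / 2 * normal_density 0 s (u - x))"
  let ?b = "\<lambda>x u. ennreal ((cmod (f u))\<^sup>2 / 2 * normal_density 0 s (u - x))"
  have "(\<integral>\<^sup>+ x. \<integral>\<^sup>+ u. ennreal (cmod (f x) * cmod (f u) * normal_density 0 s (u - x)) \<partial>lborel \<partial>lborel)
     \<le> (\<integral>\<^sup>+ x. \<integral>\<^sup>+ u. ?a x u + ?b x u \<partial>lborel \<partial>lborel)"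
  proof (intro nn_integral_mono)
    fix x u
    have "cmod (f x) * cmod (f u) \<le> (cmod (f x))\<^sup>2 / 2 + (cmod (f u))\<^sup>2 / 2"
      using sum_squares_bound[of "cmod (f x)" "cmod (f u)"] by simp
    then have "cmod (f x) * cmod (f u) * normal_density 0 s (u - x) \<le> ((cmod (f x))\<^sup>2 / 2 + (cmod (f u))\<^sup>2 / 2) * normal_density 0 s (u - x)"
      by (intro mult_right_mono) auto
    then show "ennreal (cmod (f x) * cmod (f u) * normal_density 0 s (u - x)) \<le> ?a x u + ?b x u"
      by (simp add: distrib_right flip: ennreal_plus)
  qed
  also have "\<dots> = (\<integral>\<^sup>+ x. \<integral>\<^sup>+ u. ?a x u \<partial>lborel \<partial>lborel) + (\<integral>\<^sup>+ x. \<integral>\<^sup>+ u. ?b x u \<partial>lborel \<partial>lborel)"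
    by (simp add: nn_integral_add)
  also have "(\<integral>\<^sup>+ x. \<integral>\<^sup>+ u. ?b x u \<partial>lborel \<partial>lborel) = (\<integral>\<^sup>+ u. \<integral>\<^sup>+ x. ?b x u \<partial>lborel \<partial>lborel)"
    by (rule lborel_pair.Fubini') measurable
  also have "(\<integral>\<^sup>+ u. \<integral>\<^sup>+ x. ?b x u \<partial>lborel \<partial>lborel) = (\<integral>\<^sup>+ u. ennreal ((cmod (f u))\<^sup>2 / 2) \<partial>lborel)"
    by (intro nn_integral_cong) (simp only: sh(2), rule nn_integral_cmult_normal_density, use s in auto)
  also have "(\<integral>\<^sup>+ x. \<integral>\<^sup>+ u. ?a x u \<partial>lborel \<partial>lborel) = (\<integral>\<^sup>+ u. ennreal ((cmod (f u))\<^sup>2 / 2) \<partial>lborel)"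
    by (intro nn_integral_cong) (simp only: sh(1), rule nn_integral_cmult_normal_density, use s in auto)
  also have "(\<integral>\<^sup>+ u. ennreal ((cmod (f u))\<^sup>2 / 2) \<partial>lborel) + (\<integral>\<^sup>+ u. ennreal ((cmod (f u))\<^sup>2 / 2) \<partial>lborel) = sqint f"
    unfolding sqint_def by (subst nn_integral_add[symmetric]) (auto simp flip: ennreal_plus)
  finally show ?thesis .
qed

section \<open>The contraction inequality for integrable functions\<close>

lemma borel_measurable_fourier_L1 [measurable]:
  assumes [measurable]: "f \<in> borel_measurable borel"
  shows "fourier_L1 f \<in> borel_measurable borel"
  unfolding fourier_L1_def by measurable

text \<open>The multiplication formula, applied twice, turns the Gaussian-weighted square integral of the
  transform into a double integral against a normal density, which Schur's test bounds.\<close>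

lemma sqint_fourier_L1_le:
  assumes f: "integrable lborel f"
  shows "sqint (fourier_L1 f) \<le> sqint f"
proof -
  have [measurable]: "f \<in> borel_measurable borel" using f by auto
  define A where "A = (\<lambda>w. LINT x|lborel. f x * exp (- (\<i> * complex_of_real w * complex_of_real x)))"
  have A_eq: "A w = (LINT x|lborel. f x * exp (- (\<i> * complex_of_real w * complex_of_real x)))" for w
    by (simp add: A_def)
  have [measurable]: "A \<in> borel_measurable borel" unfolding A_def by measurable
  define B where "B = (LINT x|lborel. cmod (f x))"
  have AB: "cmod (A w) \<le> B" for w
  proof -
    have "cmod (A w) \<le> (LINT x|lborel. cmod (f x * exp (- (\<i> * complex_of_real w * complex_of_real x))))"
      unfolding A_def by (rule integral_norm_bound)
    also have "\<dots> = B" by (simp add: B_def norm_mult)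
    finally show ?thesis .
  qed
  \<comment> \<open>So far \<open>A\<close> is only known to be bounded. The Gaussian damping makes
    its weighted square integrable, so that the order of integration can be exchanged.\<close>
  define J where "J = (\<lambda>d w. exp (- (d * w)\<^sup>2 / 2) :: real)"
  have [measurable]: "J d \<in> borel_measurable borel" for d unfolding J_def by measurable
  have J01: "0 \<le> J d w" "J d w \<le> 1" for d w by (auto simp: J_def)
  \<comment> \<open>The right-hand side does not depend on \<open>d\<close>; this is what allows the
    damping to be removed.\<close>
  have key: "(\<integral>\<^sup>+ w. ennreal ((cmod (A w))\<^sup>2 * J d w) \<partial>lborel) \<le> ennreal (2 * pi) * sqint f" if d: "d > 0" for d
  proof -
    have iJ: "integrable lborel (J d)"
      unfolding J_def using d by (rule integrable_scaled_gaussian)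
    have iJc: "integrable lborel (\<lambda>w. complex_of_real (J d w))"
      using iJ by simp
    have iphi: "integrable lborel (\<lambda>w. cnj (A w) * complex_of_real (J d w))"
    proof (rule Bochner_Integration.integrable_bound)
      show "integrable lborel (\<lambda>w. B * J d w)" using iJ by simp
      show "AE w in lborel. norm (cnj (A w) * complex_of_real (J d w)) \<le> norm (B * J d w)"
      proof (rule AE_I2)
        fix w
        have "cmod (A w) * J d w \<le> \<bar>B\<bar> * J d w" using AB[of w] J01[of d w] by (intro mult_right_mono) auto
        then show "norm (cnj (A w) * complex_of_real (J d w)) \<le> norm (B * J d w)"
          using J01[of d w] by (simp add: norm_mult abs_mult)
      qed
    qed measurable
    have iJe: "integrable lborel (\<lambda>w. complex_of_real (J d w) * exp (\<i> * complex_of_real w * complex_of_real x))" for x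
      by (rule Bochner_Integration.integrable_bound[OF iJ]) (auto simp: norm_mult)
    have kmeas: "(\<lambda>(x::real, w::real). exp (- (\<i> * complex_of_real w * complex_of_real x))) \<in> borel_measurable (borel \<Otimes>\<^sub>M borel)"
      by measurable
    \<comment> \<open>Conjugating moves the conjugate away from \<open>A\<close>, so the
      multiplication formula can be applied a second time; the inner transform of the damping is
      then a normal density centred at \<open>x\<close>.\<close>
    have inner: "(LINT w|lborel. cnj (A w) * complex_of_real (J d w) * exp (- (\<i> * complex_of_real w * complex_of_real x)))
      = cnj (LINT u|lborel. f u * complex_of_real (2 * pi * normal_density 0 d (u - x)))" for x
    proof -
      have "(LINT w|lborel. cnj (A w) * complex_of_real (J d w) * exp (- (\<i> * complex_of_real w * complex_of_real x)))
        = (LINT w|lborel. cnj (A w * (complex_of_real (J d w) * exp (\<i> * complex_of_real w * complex_of_real x))))"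
        by (intro Bochner_Integration.integral_cong refl) (simp add: exp_cnj)
      also have "\<dots> = cnj (LINT w|lborel. A w * (complex_of_real (J d w) * exp (\<i> * complex_of_real w * complex_of_real x)))"
        by (rule Bochner_Integration.integral_cnj)
      also have "(LINT w|lborel. A w * (complex_of_real (J d w) * exp (\<i> * complex_of_real w * complex_of_real x)))
        = (LINT u|lborel. f u * (LINT w|lborel. complex_of_real (J d w) * exp (\<i> * complex_of_real w * complex_of_real x) * exp (- (\<i> * complex_of_real w * complex_of_real u))))"
        unfolding A_def
        by (rule integral_kernel_swap[OF f iJe, where k="\<lambda>x w. exp (- (\<i> * complex_of_real w * complex_of_real x))"])
           (use kmeas in auto)
      also have "\<dots> = (LINT u|lborel. f u * complex_of_real (2 * pi * normal_density 0 d (u - x)))"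
      proof -
        have J: "complex_of_real (J d w) = exp (- (complex_of_real (d * w))\<^sup>2 / 2)" for w
          by (simp add: J_def exp_of_real[symmetric])
        have "complex_of_real (J d w) * exp (\<i> * complex_of_real w * complex_of_real x) * exp (- (\<i> * complex_of_real w * complex_of_real u))
          = exp (- (complex_of_real (d * w))\<^sup>2 / 2) * exp (- (\<i> * complex_of_real (u - x) * complex_of_real w))" for u w
          unfolding J mult_exp_exp by (rule arg_cong[of _ _ exp]) (simp add: algebra_simps)
        then show ?thesis
          by (simp only: integral_scaled_gaussian[OF d])
      qed
      finally show ?thesis .
    qed
    have "(\<integral>\<^sup>+ w. ennreal ((cmod (A w))\<^sup>2 * J d w) \<partial>lborel) = ennreal (LINT w|lborel. (cmod (A w))\<^sup>2 * J d w)"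
    proof (rule nn_integral_eq_integral)
      have "integrable lborel (\<lambda>w. cnj (A w) * complex_of_real (J d w) * A w)"
      proof (rule Bochner_Integration.integrable_bound)
        show "integrable lborel (\<lambda>w. (cnj (A w) * complex_of_real (J d w)) * complex_of_real B)"
          using iphi by (intro integrable_mult_left)
        show "AE w in lborel. norm (cnj (A w) * complex_of_real (J d w) * A w) \<le> norm ((cnj (A w) * complex_of_real (J d w)) * complex_of_real B)"
          by (rule AE_I2) (auto simp: norm_mult intro!: mult_left_mono order_trans[OF AB])
      qed measurable
      then have "integrable lborel (\<lambda>w. cmod (cnj (A w) * complex_of_real (J d w) * A w))"
        by (rule integrable_norm)
      then show "integrable lborel (\<lambda>w. (cmod (A w))\<^sup>2 * J d w)"
        using J01 by (simp add: norm_mult power2_eq_square mult_ac)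
    qed (use J01 in auto)
    \<comment> \<open>The integral is real and nonnegative, hence equal to its modulus. After the
      exchange of integrals only a bound on the modulus is accessible.\<close>
    also have "(LINT w|lborel. (cmod (A w))\<^sup>2 * J d w) = cmod (LINT w|lborel. A w * (cnj (A w) * complex_of_real (J d w)))"
    proof -
      have "(LINT w|lborel. A w * (cnj (A w) * complex_of_real (J d w))) = (LINT w|lborel. complex_of_real ((cmod (A w))\<^sup>2 * J d w))"
        by (intro Bochner_Integration.integral_cong refl) (simp add: complex_norm_square[symmetric] flip: mult.assoc)
      also have "\<dots> = complex_of_real (LINT w|lborel. (cmod (A w))\<^sup>2 * J d w)" by (rule integral_complex_of_real)
      moreover have "0 \<le> (LINT w|lborel. (cmod (A w))\<^sup>2 * J d w)"
        by (rule integral_nonneg_AE) (use J01 in auto)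
      ultimately show ?thesis by simp
    qed
    also have "(LINT w|lborel. A w * (cnj (A w) * complex_of_real (J d w)))
       = (LINT x|lborel. f x * (LINT w|lborel. cnj (A w) * complex_of_real (J d w) * exp (- (\<i> * complex_of_real w * complex_of_real x))))"
      using integral_kernel_swap[OF f iphi, where k="\<lambda>x w. exp (- (\<i> * complex_of_real w * complex_of_real x))"] kmeas
      by (simp add: A_eq[symmetric])
    also have "\<dots> = (LINT x|lborel. f x * cnj (LINT u|lborel. f u * complex_of_real (2 * pi * normal_density 0 d (u - x))))"
      unfolding inner ..
    also have "ennreal (cmod \<dots>) \<le> (\<integral>\<^sup>+ x. ennreal (cmod (f x * cnj (LINT u|lborel. f u * complex_of_real (2 * pi * normal_density 0 d (u - x))))) \<partial>lborel)"
      by (rule integral_norm_bound_ennreal_any)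
    also have "\<dots> \<le> (\<integral>\<^sup>+ x. ennreal (cmod (f x)) * (\<integral>\<^sup>+ u. ennreal (cmod (f u * complex_of_real (2 * pi * normal_density 0 d (u - x)))) \<partial>lborel) \<partial>lborel)"
      by (intro nn_integral_mono)
         (simp only: norm_mult[of "f _" "cnj _"] complex_mod_cnj ennreal_mult' norm_ge_zero mult_left_mono integral_norm_bound_ennreal_any zero_le)
    also have "\<dots> = (\<integral>\<^sup>+ x. \<integral>\<^sup>+ u. ennreal (2 * pi) * ennreal (cmod (f x) * cmod (f u) * normal_density 0 d (u - x)) \<partial>lborel \<partial>lborel)"
      by (auto simp: nn_integral_cmult[symmetric] norm_mult ennreal_mult[symmetric] mult_ac intro!: nn_integral_cong)
    also have "\<dots> = ennreal (2 * pi) * (\<integral>\<^sup>+ x. \<integral>\<^sup>+ u. ennreal (cmod (f x) * cmod (f u) * normal_density 0 d (u - x)) \<partial>lborel \<partial>lborel)"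
      by (simp add: nn_integral_cmult)
    also have "\<dots> \<le> ennreal (2 * pi) * sqint f"
      by (intro mult_left_mono schur_normal_density d) auto
    finally show ?thesis .
  qed
  have "(\<integral>\<^sup>+ w. ennreal ((cmod (A w))\<^sup>2) \<partial>lborel) = (\<integral>\<^sup>+ w. liminf (\<lambda>n. ennreal ((cmod (A w))\<^sup>2 * J (inverse (real (Suc n))) w)) \<partial>lborel)"
  proof (intro nn_integral_cong)
    fix w
    have "(\<lambda>n. J (inverse (real (Suc n))) w) \<longlonglongrightarrow> exp (- (0 * w)\<^sup>2 / 2)"
      unfolding J_def by (intro tendsto_intros LIMSEQ_inverse_real_of_nat) auto
    then have "(\<lambda>n. ennreal ((cmod (A w))\<^sup>2 * J (inverse (real (Suc n))) w)) \<longlonglongrightarrow> ennreal ((cmod (A w))\<^sup>2 * 1)"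
      by (intro tendsto_ennrealI tendsto_intros) simp
    then show "ennreal ((cmod (A w))\<^sup>2) = liminf (\<lambda>n. ennreal ((cmod (A w))\<^sup>2 * J (inverse (real (Suc n))) w))"
      by (simp add: lim_imp_Liminf)
  qed
  \<comment> \<open>Fatou's lemma along \<open>d = 1 / (n + 1)\<close>, as the damping factor tends
    to 1 pointwise.\<close>
  also have "\<dots> \<le> liminf (\<lambda>n. \<integral>\<^sup>+ w. ennreal ((cmod (A w))\<^sup>2 * J (inverse (real (Suc n))) w) \<partial>lborel)"
    by (rule nn_integral_liminf) measurable
  also have "\<dots> \<le> ennreal (2 * pi) * sqint f"
    by (intro Liminf_le always_eventually allI key) auto
  finally have *: "(\<integral>\<^sup>+ w. ennreal ((cmod (A w))\<^sup>2) \<partial>lborel) \<le> ennreal (2 * pi) * sqint f" .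
  have "sqint (fourier_L1 f) = (\<integral>\<^sup>+ w. ennreal (1 / (2 * pi)) * ennreal ((cmod (A w))\<^sup>2) \<partial>lborel)"
    unfolding sqint_def fourier_L1_def A_def
    by (intro nn_integral_cong) (simp add: norm_mult norm_divide power_mult_distrib power_divide flip: ennreal_mult)
  also have "\<dots> = ennreal (1 / (2 * pi)) * (\<integral>\<^sup>+ w. ennreal ((cmod (A w))\<^sup>2) \<partial>lborel)"
    by (rule nn_integral_cmult) measurable
  also have "\<dots> \<le> ennreal (1 / (2 * pi)) * (ennreal (2 * pi) * sqint f)"
    by (intro mult_left_mono *) auto
  also have "\<dots> = sqint f"
    by (simp add: mult.assoc[symmetric] ennreal_mult[symmetric])
  finally show ?thesis .
qed

section \<open>The space \<open>L\<^sup>2\<close>\<close>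

lemma L2_iff: "f \<in> L2 \<longleftrightarrow> f \<in> borel_measurable borel \<and> sqint f < \<infinity>"
  by (auto simp: L2_def sqint_def integrable_iff_bounded)

lemma L2_measurable: "f \<in> L2 \<Longrightarrow> f \<in> borel_measurable borel"
  by (simp add: L2_iff)

lemma L2_integrable: "f \<in> L2 \<Longrightarrow> integrable lborel (\<lambda>x. (cmod (f x))\<^sup>2)"
  by (simp add: L2_def)

lemma sqint_eq_L2_norm: "f \<in> L2 \<Longrightarrow> sqint f = ennreal ((L2_norm f)\<^sup>2)"
  by (simp add: sqint_def L2_norm_def nn_integral_eq_integral L2_integrable)

lemma L2_norm_nonneg [simp]: "0 \<le> L2_norm f"
  by (simp add: L2_norm_def)

lemma L2_norm_le_iff:
  assumes "f \<in> L2" "0 \<le> c"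
  shows "L2_norm f \<le> c \<longleftrightarrow> sqint f \<le> ennreal (c\<^sup>2)"
  using assms by (auto simp: sqint_eq_L2_norm intro!: power_mono intro: power2_le_imp_le)

lemma sqint_mono: "(\<And>x. cmod (f x) \<le> cmod (g x)) \<Longrightarrow> sqint f \<le> sqint g"
  unfolding sqint_def by (intro nn_integral_mono) (auto intro!: power_mono ennreal_leI)

lemma sqint_cmult: "f \<in> borel_measurable borel \<Longrightarrow> sqint (\<lambda>x. c * f x) = ennreal ((cmod c)\<^sup>2) * sqint f"
  unfolding sqint_def by (subst nn_integral_cmult[symmetric]) (auto simp: norm_mult power_mult_distrib ennreal_mult)

text \<open>The crude constant 2 comes from (s + t)^2 <= 2 s^2 + 2 t^2. It suffices for closure of
  \<open>L2\<close> under addition and for Cauchy estimates, before the sharp triangle inequality is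
  at hand.\<close>

lemma sqint_add_le:
  assumes [measurable]: "f \<in> borel_measurable borel" "g \<in> borel_measurable borel"
  shows "sqint (\<lambda>x. f x + g x) \<le> 2 * sqint f + 2 * sqint g"
proof -
  have "sqint (\<lambda>x. f x + g x) \<le> (\<integral>\<^sup>+ x. 2 * ennreal ((cmod (f x))\<^sup>2) + 2 * ennreal ((cmod (g x))\<^sup>2) \<partial>lborel)"
    unfolding sqint_def
  proof (intro nn_integral_mono)
    fix x
    have "(cmod (f x + g x))\<^sup>2 \<le> (cmod (f x) + cmod (g x))\<^sup>2"
      by (intro power_mono norm_triangle_ineq) auto
    also have "\<dots> \<le> 2 * (cmod (f x))\<^sup>2 + 2 * (cmod (g x))\<^sup>2"
      using sum_squares_bound[of "cmod (f x)" "cmod (g x)"] by (simp add: power2_sum)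
    finally have "ennreal ((cmod (f x + g x))\<^sup>2) \<le> ennreal (2 * (cmod (f x))\<^sup>2 + 2 * (cmod (g x))\<^sup>2)"
      by (rule ennreal_leI)
    also have "\<dots> = 2 * ennreal ((cmod (f x))\<^sup>2) + 2 * ennreal ((cmod (g x))\<^sup>2)"
      by (simp add: ennreal_mult)
    finally show "ennreal ((cmod (f x + g x))\<^sup>2) \<le> 2 * ennreal ((cmod (f x))\<^sup>2) + 2 * ennreal ((cmod (g x))\<^sup>2)" .
  qed
  also have "\<dots> = 2 * sqint f + 2 * sqint g"
    by (simp add: sqint_def nn_integral_add nn_integral_cmult)
  finally show ?thesis .
qed

lemma L2_add: "f \<in> L2 \<Longrightarrow> g \<in> L2 \<Longrightarrow> (\<lambda>x. f x + g x) \<in> L2"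
  using sqint_add_le[of f g] by (auto simp: L2_iff ennreal_mult_less_top elim!: le_less_trans)

lemma L2_cmult: "f \<in> L2 \<Longrightarrow> (\<lambda>x. c * f x) \<in> L2"
  by (auto simp: L2_iff sqint_cmult ennreal_mult_less_top)

lemma L2_diff: "f \<in> L2 \<Longrightarrow> g \<in> L2 \<Longrightarrow> (\<lambda>x. f x - g x) \<in> L2"
  using L2_add[OF _ L2_cmult, of f g "-1"] by simp

lemma L2_bound:
  assumes "g \<in> L2" "f \<in> borel_measurable borel" "\<And>x. cmod (f x) \<le> cmod (g x)"
  shows "f \<in> L2"
  using assms sqint_mono[of f g] by (auto simp: L2_iff)

lemma L2_norm_minus_commute: "L2_norm (\<lambda>x. f x - g x) = L2_norm (\<lambda>x. g x - f x)"
  by (simp add: L2_norm_def norm_minus_commute)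

section \<open>Pairing, triangle inequality and completeness in L^2\<close>

lemma L2_mult_integrable:
  assumes f: "f \<in> L2" and g: "g \<in> L2"
  shows "integrable lborel (\<lambda>x. f x * g x)"
proof (rule Bochner_Integration.integrable_bound)
  show "integrable lborel (\<lambda>x. (cmod (f x))\<^sup>2 + (cmod (g x))\<^sup>2)"
    using f g by (intro Bochner_Integration.integrable_add L2_integrable)
  have [measurable]: "f \<in> borel_measurable borel" "g \<in> borel_measurable borel"
    using f g by (auto simp: L2_iff)
  show "(\<lambda>x. f x * g x) \<in> borel_measurable lborel" by measurable
  show "AE x in lborel. norm (f x * g x) \<le> norm ((cmod (f x))\<^sup>2 + (cmod (g x))\<^sup>2)"
  proof (rule AE_I2)
    fix x
    have "cmod (f x) * cmod (g x) \<le> (cmod (f x))\<^sup>2 + (cmod (g x))\<^sup>2"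
      using sum_squares_bound[of "cmod (f x)" "cmod (g x)"]
        mult_nonneg_nonneg[OF norm_ge_zero norm_ge_zero, of "f x" "g x"] by linarith
    then show "norm (f x * g x) \<le> norm ((cmod (f x))\<^sup>2 + (cmod (g x))\<^sup>2)"
      by (simp add: norm_mult)
  qed
qed

lemma L2_Cauchy_Schwarz:
  assumes f: "f \<in> L2" and g: "g \<in> L2"
  shows "(LINT x|lborel. cmod (f x) * cmod (g x)) \<le> L2_norm f * L2_norm g"
proof -
  have int: "integrable lborel (\<lambda>x. cmod (f x) * cmod (g x))"
    using integrable_norm[OF L2_mult_integrable[OF f g]] by (simp add: norm_mult)
  have zero: "(LINT x|lborel. cmod (u x) * cmod (v x)) = 0" if "u \<in> L2" "L2_norm u = 0" for u v
  proof -
    have "(LINT x|lborel. (cmod (u x))\<^sup>2) = 0" using that by (simp add: L2_norm_def)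
    then have "AE x in lborel. (cmod (u x))\<^sup>2 = 0"
      using integral_nonneg_eq_0_iff_AE[OF L2_integrable[OF that(1)]] by simp
    then have "AE x in lborel. cmod (u x) * cmod (v x) = 0"
      by eventually_elim simp
    then show ?thesis by (rule integral_eq_zero_AE)
  qed
  show ?thesis
  proof (cases "L2_norm f = 0 \<or> L2_norm g = 0")
    case True
    then show ?thesis
      using zero[OF f, of g] zero[OF g, of f] by (auto simp: mult.commute)
  next
    case False
    define p q where "p = L2_norm f" and "q = L2_norm g"
    have pq: "p > 0" "q > 0" using False L2_norm_nonneg[of f] L2_norm_nonneg[of g] by (auto simp: p_def q_def less_le)
    have p2: "(LINT x|lborel. (cmod (f x))\<^sup>2) = p\<^sup>2" and q2: "(LINT x|lborel. (cmod (g x))\<^sup>2) = q\<^sup>2"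
      by (auto simp: p_def q_def L2_norm_def)
    \<comment> \<open>The weights come from expanding the square of
      \<open>q * cmod (f x) - p * cmod (g x)\<close> and dividing by \<open>2 * p * q\<close>; after
      integration each of the two terms contributes \<open>p * q / 2\<close>.\<close>
    have "(LINT x|lborel. cmod (f x) * cmod (g x)) \<le> (LINT x|lborel. (q / (2 * p)) * (cmod (f x))\<^sup>2 + (p / (2 * q)) * (cmod (g x))\<^sup>2)"
    proof (rule integral_mono[OF int])
      show "integrable lborel (\<lambda>x. (q / (2 * p)) * (cmod (f x))\<^sup>2 + (p / (2 * q)) * (cmod (g x))\<^sup>2)"
        using f g by (intro Bochner_Integration.integrable_add integrable_mult_right L2_integrable)
      fix x
      have "0 \<le> (q * cmod (f x) - p * cmod (g x))\<^sup>2 / (2 * p * q)" using pq by simp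
      also have "\<dots> = (q / (2 * p)) * (cmod (f x))\<^sup>2 + (p / (2 * q)) * (cmod (g x))\<^sup>2 - cmod (f x) * cmod (g x)"
        using pq by (simp add: field_simps power2_eq_square)
      finally show "cmod (f x) * cmod (g x) \<le> (q / (2 * p)) * (cmod (f x))\<^sup>2 + (p / (2 * q)) * (cmod (g x))\<^sup>2" by simp
    qed
    also have "\<dots> = (q / (2 * p)) * p\<^sup>2 + (p / (2 * q)) * q\<^sup>2"
      using f g by (simp add: L2_integrable p2 q2)
    also have "\<dots> = p * q" using pq by (simp add: field_simps power2_eq_square)
    finally show ?thesis by (simp add: p_def q_def)
  qed
qed

lemma norm_integral_mult_le:
  assumes f: "f \<in> L2" and g: "g \<in> L2"
  shows "cmod (LINT x|lborel. f x * g x) \<le> L2_norm f * L2_norm g"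
proof -
  have "cmod (LINT x|lborel. f x * g x) \<le> (LINT x|lborel. cmod (f x * g x))"
    by (rule integral_norm_bound)
  also have "\<dots> \<le> L2_norm f * L2_norm g"
    using L2_Cauchy_Schwarz[OF f g] by (simp add: norm_mult)
  finally show ?thesis .
qed

lemma L2_norm_triangle:
  assumes f: "f \<in> L2" and g: "g \<in> L2"
  shows "L2_norm (\<lambda>x. f x + g x) \<le> L2_norm f + L2_norm g"
proof (rule power2_le_imp_le)
  have int: "integrable lborel (\<lambda>x. cmod (f x) * cmod (g x))"
    using integrable_norm[OF L2_mult_integrable[OF f g]] by (simp add: norm_mult)
  have sq: "(L2_norm u)\<^sup>2 = (LINT x|lborel. (cmod (u x))\<^sup>2)" for u by (simp add: L2_norm_def)
  have "(L2_norm (\<lambda>x. f x + g x))\<^sup>2 \<le> (LINT x|lborel. ((cmod (f x))\<^sup>2 + (cmod (g x))\<^sup>2) + 2 * (cmod (f x) * cmod (g x)))"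
    unfolding sq
  proof (rule integral_mono)
    show "integrable lborel (\<lambda>x. ((cmod (f x))\<^sup>2 + (cmod (g x))\<^sup>2) + 2 * (cmod (f x) * cmod (g x)))"
      using int f g by (intro Bochner_Integration.integrable_add integrable_mult_right L2_integrable)
    fix x
    have "(cmod (f x + g x))\<^sup>2 \<le> (cmod (f x) + cmod (g x))\<^sup>2"
      by (intro power_mono norm_triangle_ineq) auto
    then show "(cmod (f x + g x))\<^sup>2 \<le> ((cmod (f x))\<^sup>2 + (cmod (g x))\<^sup>2) + 2 * (cmod (f x) * cmod (g x))"
      by (simp add: power2_sum)
  qed (use L2_integrable[OF L2_add[OF f g]] in simp)
  also have "\<dots> = (L2_norm f)\<^sup>2 + (L2_norm g)\<^sup>2 + 2 * (LINT x|lborel. cmod (f x) * cmod (g x))"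
    unfolding sq using int f g by (simp add: L2_integrable)
  also have "\<dots> \<le> (L2_norm f + L2_norm g)\<^sup>2"
    using L2_Cauchy_Schwarz[OF f g] by (simp add: power2_sum)
  finally show "(L2_norm (\<lambda>x. f x + g x))\<^sup>2 \<le> (L2_norm f + L2_norm g)\<^sup>2" .
qed simp

lemma tendsto_integral_mult_L2:
  assumes u: "\<And>n. u n \<in> L2" and f: "f \<in> L2" and g: "g \<in> L2"
    and lim: "(\<lambda>n. L2_norm (\<lambda>x. u n x - f x)) \<longlonglongrightarrow> 0"
  shows "(\<lambda>n. LINT x|lborel. u n x * g x) \<longlonglongrightarrow> (LINT x|lborel. f x * g x)"
proof -
  have "(\<lambda>n. (LINT x|lborel. u n x * g x) - (LINT x|lborel. f x * g x)) \<longlonglongrightarrow> 0"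
  proof (rule Lim_null_comparison)
    show "(\<lambda>n. L2_norm (\<lambda>x. u n x - f x) * L2_norm g) \<longlonglongrightarrow> 0"
      using tendsto_mult_right[OF lim, of "L2_norm g"] by simp
    show "\<forall>\<^sub>F n in sequentially. norm ((LINT x|lborel. u n x * g x) - (LINT x|lborel. f x * g x)) \<le> L2_norm (\<lambda>x. u n x - f x) * L2_norm g"
    proof (rule always_eventually, rule allI)
      fix n
      have "(LINT x|lborel. u n x * g x) - (LINT x|lborel. f x * g x) = (LINT x|lborel. (u n x - f x) * g x)"
        using L2_mult_integrable[OF u g] L2_mult_integrable[OF f g]
        by (simp add: left_diff_distrib)
      then show "norm ((LINT x|lborel. u n x * g x) - (LINT x|lborel. f x * g x)) \<le> L2_norm (\<lambda>x. u n x - f x) * L2_norm g"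
        using norm_integral_mult_le[OF L2_diff[OF u f] g] by simp
    qed
  qed
  then show ?thesis by (simp add: LIM_zero_iff)
qed

text \<open>The rate \<open>8 ^ n\<close> leaves room for a weight \<open>2 ^ n\<close>: the
  weighted squares of the increments still have a convergent series of integrals, hence a finite sum
  almost everywhere. Since |d| <= 2^n |d|^2 + 2^(-n), the increments themselves are then absolutely
  summable, and the sequence converges pointwise almost everywhere.\<close>

lemma L2_fast_Cauchy_limit:
  assumes [measurable]: "\<And>n. u n \<in> borel_measurable borel"
    and c: "0 \<le> c"
    and cauchy: "\<And>m n. n \<le> m \<Longrightarrow> sqint (\<lambda>x. u m x - u n x) \<le> ennreal (c / 8 ^ n)"
  obtains F where "F \<in> borel_measurable borel" "\<And>n. sqint (\<lambda>x. F x - u n x) \<le> ennreal (c / 8 ^ n)"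
proof -
  define d where "d = (\<lambda>n x. u (Suc n) x - u n x)"
  have [measurable]: "d n \<in> borel_measurable borel" for n unfolding d_def by measurable
  have "(\<integral>\<^sup>+ x. (\<Sum>n. ennreal (2 ^ n * (cmod (d n x))\<^sup>2)) \<partial>lborel) = (\<Sum>n. \<integral>\<^sup>+ x. ennreal (2 ^ n * (cmod (d n x))\<^sup>2) \<partial>lborel)"
    by (rule nn_integral_suminf) measurable
  also have "\<dots> = (\<Sum>n. ennreal (2 ^ n) * sqint (d n))"
    unfolding sqint_def by (intro suminf_cong) (simp add: ennreal_mult nn_integral_cmult)
  also have "\<dots> \<le> (\<Sum>n. ennreal (2 ^ n) * ennreal (c / 8 ^ n))"
    unfolding d_def by (intro suminf_le mult_left_mono cauchy) auto
  also have "\<dots> = (\<Sum>n. ennreal (c * (1 / 4) ^ n))"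
  proof (intro suminf_cong)
    fix n
    have "(8::real) ^ n = 2 ^ n * 4 ^ n" by (simp flip: power_mult_distrib)
    then show "ennreal (2 ^ n) * ennreal (c / 8 ^ n) = ennreal (c * (1 / 4) ^ n)"
      using c by (simp add: power_divide flip: ennreal_mult)
  qed
  also have "\<dots> = ennreal (\<Sum>n. c * (1 / 4) ^ n)"
    using c by (intro suminf_ennreal2 summable_mult summable_geometric) auto
  finally have "(\<integral>\<^sup>+ x. (\<Sum>n. ennreal (2 ^ n * (cmod (d n x))\<^sup>2)) \<partial>lborel) \<noteq> \<infinity>"
    by (auto simp: top_unique)
  then have "AE x in lborel. (\<Sum>n. ennreal (2 ^ n * (cmod (d n x))\<^sup>2)) \<noteq> \<infinity>"
    by (intro nn_integral_PInf_AE) measurable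
  then have conv: "AE x in lborel. convergent (\<lambda>n. u n x)"
  proof eventually_elim
    fix x
    assume "(\<Sum>n. ennreal (2 ^ n * (cmod (d n x))\<^sup>2)) \<noteq> \<infinity>"
    then have "summable (\<lambda>n. 2 ^ n * (cmod (d n x))\<^sup>2)"
      by (intro summable_suminf_not_top) auto
    then have "summable (\<lambda>n. 2 ^ n * (cmod (d n x))\<^sup>2 + (1 / 2) ^ n)"
      by (intro summable_add summable_geometric) auto
    then have "summable (\<lambda>n. d n x)"
    proof (rule summable_comparison_test'[where N=0])
      fix n
      define t where "t = cmod (d n x)"
      have "t \<le> 2 ^ n * t\<^sup>2 + (1 / 2) ^ n"
      \<comment> \<open>Above the threshold \<open>2 ^ n * t\<close> exceeds 1, so the quadratic
        term alone dominates \<open>t\<close>.\<close>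
      proof (cases "t \<le> (1 / 2) ^ n")
        case False
        then have "1 * t \<le> (2 ^ n * t) * t"
          by (intro mult_right_mono) (auto simp: t_def power_divide field_simps)
        then show ?thesis by (simp add: power2_eq_square mult_ac add_increasing2)
      qed (simp add: add_increasing)
      then show "norm (d n x) \<le> 2 ^ n * (cmod (d n x))\<^sup>2 + (1 / 2) ^ n" by (simp add: t_def)
    qed
    then have "convergent (\<lambda>n. (\<Sum>i<n. d i x) + u 0 x)"
      by (intro convergent_add convergent_const) (simp add: summable_iff_convergent)
    then show "convergent (\<lambda>n. u n x)"
      unfolding d_def sum_lessThan_telescope[of "\<lambda>i. u i x"] by simp
  qed
  define F where "F = (\<lambda>x. lim (\<lambda>n. u n x))"
  have [measurable]: "F \<in> borel_measurable borel"
    unfolding F_def by (rule borel_measurable_lim_metric) measurable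
  have lim: "AE x in lborel. (\<lambda>n. u n x) \<longlonglongrightarrow> F x"
    using conv by eventually_elim (simp add: F_def convergent_LIMSEQ_iff)
  show thesis
  proof
    fix n
    \<comment> \<open>Fatou's lemma in \<open>m\<close> with \<open>n\<close> fixed carries the
      Cauchy estimate over to the limit with the same constant.\<close>
    have "sqint (\<lambda>x. F x - u n x) = (\<integral>\<^sup>+ x. liminf (\<lambda>m. ennreal ((cmod (u m x - u n x))\<^sup>2)) \<partial>lborel)"
      unfolding sqint_def
    proof (rule nn_integral_cong_AE, use lim in eventually_elim)
      fix x assume "(\<lambda>n. u n x) \<longlonglongrightarrow> F x"
      then have "(\<lambda>m. ennreal ((cmod (u m x - u n x))\<^sup>2)) \<longlonglongrightarrow> ennreal ((cmod (F x - u n x))\<^sup>2)"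
        by (intro tendsto_intros)
      then show "ennreal ((cmod (F x - u n x))\<^sup>2) = liminf (\<lambda>m. ennreal ((cmod (u m x - u n x))\<^sup>2))"
        by (rule lim_imp_Liminf[OF trivial_limit_sequentially, symmetric])
    qed
    also have "\<dots> \<le> liminf (\<lambda>m. sqint (\<lambda>x. u m x - u n x))"
      unfolding sqint_def by (rule nn_integral_liminf) measurable
    also have "\<dots> \<le> ennreal (c / 8 ^ n)"
      by (intro Liminf_le eventually_mono[OF eventually_ge_at_top[of n]] cauchy) auto
    finally show "sqint (\<lambda>x. F x - u n x) \<le> ennreal (c / 8 ^ n)" .
  qed fact
qed

section \<open>The Fourier transform on \<open>L\<^sup>2\<close>\<close>

lemma fourier_L1_L2:
  assumes "integrable lborel s" "s \<in> L2"
  shows "fourier_L1 s \<in> L2" "L2_norm (fourier_L1 s) \<le> L2_norm s"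
proof -
  show *: "fourier_L1 s \<in> L2"
    using assms sqint_fourier_L1_le[of s] by (auto simp: L2_iff)
  show "L2_norm (fourier_L1 s) \<le> L2_norm s"
    unfolding L2_norm_le_iff[OF * L2_norm_nonneg] sqint_eq_L2_norm[OF assms(2), symmetric]
    by (rule sqint_fourier_L1_le) fact
qed

lemma fourier_L1_diff:
  assumes f: "integrable lborel f" and g: "integrable lborel g"
  shows "fourier_L1 (\<lambda>x. f x - g x) w = fourier_L1 f w - fourier_L1 g w"
proof -
  have int: "integrable lborel (\<lambda>x. h x * exp (- (\<i> * complex_of_real w * complex_of_real x)))"
    if "integrable lborel h" for h :: "real \<Rightarrow> complex"
  proof (rule Bochner_Integration.integrable_bound[OF that])
    have [measurable]: "h \<in> borel_measurable borel" using that by auto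
    show "(\<lambda>x. h x * exp (- (\<i> * complex_of_real w * complex_of_real x))) \<in> borel_measurable lborel" by measurable
  qed (simp add: norm_mult)
  show ?thesis
    unfolding fourier_L1_def using int[OF f] int[OF g]
    by (simp add: left_diff_distrib right_diff_distrib diff_divide_distrib)
qed

lemma L2_norm_tendsto_0:
  assumes g: "\<And>n. g n \<in> L2" and e: "e \<longlonglongrightarrow> 0" "\<And>n. sqint (g n) \<le> ennreal (e n)"
    and e0: "\<And>n::nat. 0 \<le> e n"
  shows "(\<lambda>n. L2_norm (g n)) \<longlonglongrightarrow> 0"
proof (rule Lim_null_comparison)
  show "(\<lambda>n. sqrt (e n)) \<longlonglongrightarrow> 0" using tendsto_real_sqrt[OF e(1)] by simp
  show "\<forall>\<^sub>F n in sequentially. norm (L2_norm (g n)) \<le> sqrt (e n)"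
    using g e e0 by (intro always_eventually allI) (simp add: L2_norm_le_iff)
qed

lemma L2_truncation:
  assumes f: "f \<in> L2" and e: "e > 0"
  obtains R :: real where "sqint (\<lambda>x. indicator {-R..R} x * f x - f x) \<le> ennreal e"
proof -
  have [measurable]: "f \<in> borel_measurable borel" using f by (simp add: L2_iff)
  have "(\<lambda>n. \<integral>\<^sup>+ x. ennreal ((cmod (indicator {-real n..real n} x * f x - f x))\<^sup>2) \<partial>lborel) \<longlonglongrightarrow> (\<integral>\<^sup>+ x. 0 \<partial>(lborel :: real measure))"
  proof (rule nn_integral_dominated_convergence)
    show "(\<integral>\<^sup>+ x. ennreal ((cmod (f x))\<^sup>2) \<partial>lborel) < \<infinity>" using f by (simp add: L2_iff sqint_def)
    show "AE x in lborel. (\<lambda>n. ennreal ((cmod (indicator {-real n..real n} x * f x - f x))\<^sup>2)) \<longlonglongrightarrow> 0"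
    proof (rule AE_I2, rule tendsto_eventually)
      fix x :: real
      obtain m where m: "\<bar>x\<bar> \<le> real m" using real_arch_simple by blast
      show "\<forall>\<^sub>F n in sequentially. ennreal ((cmod (indicator {-real n..real n} x * f x - f x))\<^sup>2) = 0"
        using eventually_ge_at_top[of m] by eventually_elim (use m in \<open>auto simp: indicator_def\<close>)
    qed
    show "AE x in lborel. ennreal ((cmod (indicator {-real n..real n} x * f x - f x))\<^sup>2) \<le> ennreal ((cmod (f x))\<^sup>2)" for n
      by (rule AE_I2) (auto simp: indicator_def)
  qed measurable
  then have "\<forall>\<^sub>F n in sequentially. (\<integral>\<^sup>+ x. ennreal ((cmod (indicator {-real n..real n} x * f x - f x))\<^sup>2) \<partial>lborel) < ennreal e"
    using e by (intro order_tendstoD(2)) auto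
  then obtain n where "(\<integral>\<^sup>+ x. ennreal ((cmod (indicator {-real n..real n} x * f x - f x))\<^sup>2) \<partial>lborel) < ennreal e"
    by (auto simp: eventually_sequentially)
  then show thesis by (intro that[of "real n"]) (simp add: sqint_def less_imp_le)
qed

text \<open>The indicator of a bounded interval is itself in \<open>L2\<close>, so this is the
  product of two square integrable functions.\<close>

lemma L2_truncation_integrable:
  assumes f: "f \<in> L2"
  shows "integrable lborel (\<lambda>x. indicator {-R..R} x * f x)"
proof -
  have [measurable]: "f \<in> borel_measurable borel" using f by (simp add: L2_iff)
  have "(\<lambda>x. indicator {-R..R} x :: complex) \<in> L2"
  proof -
    have "sqint (\<lambda>x. indicator {-R..R} x) = (\<integral>\<^sup>+ x. indicator {-R..R} x \<partial>lborel)"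
      unfolding sqint_def by (intro nn_integral_cong) (auto simp: indicator_def)
    also have "\<dots> < \<infinity>" by (simp add: emeasure_lborel_Icc_eq)
    finally show ?thesis by (simp add: L2_iff)
  qed
  then show ?thesis using f by (rule L2_mult_integrable)
qed

text \<open>Truncations of \<open>f\<close> are integrable and square integrable. The contraction
  inequality transfers their Cauchy property to the transforms, and completeness provides the
  limit.\<close>

lemma has_L2_fourier_ex:
  assumes f: "f \<in> L2"
  shows "\<exists>F. has_L2_fourier f F"
proof -
  have [measurable]: "f \<in> borel_measurable borel" using f by (simp add: L2_iff)
  \<comment> \<open>The factor 1/4 compensates for the difference of two truncations: two errors,
    each doubled by \<open>sqint_add_le\<close>.\<close>
  have "\<exists>R::real. sqint (\<lambda>x. indicator {-R..R} x * f x - f x) \<le> ennreal (1 / 4 / 8 ^ n)" for n :: nat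
    using L2_truncation[OF f, of "1 / 4 / 8 ^ n"] by auto
  then obtain R where R: "\<And>n::nat. sqint (\<lambda>x. indicator {-R n..R n :: real} x * f x - f x) \<le> ennreal (1 / 4 / 8 ^ n)"
    by metis
  define s where "s = (\<lambda>n x. indicator {-R n..R n} x * f x)"
  have [measurable]: "s n \<in> borel_measurable borel" for n unfolding s_def by measurable
  have si: "integrable lborel (s n)" for n
    unfolding s_def by (rule L2_truncation_integrable[OF f])
  have s2: "s n \<in> L2" for n
    by (rule L2_bound[OF f]) (auto simp: s_def indicator_def)
  have sf: "sqint (\<lambda>x. s n x - f x) \<le> ennreal (1 / 4 / 8 ^ n)" for n
    unfolding s_def by (rule R)
  have sq_comm: "sqint (\<lambda>x. g x - h x) = sqint (\<lambda>x. h x - g x)" for g h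
    by (simp add: sqint_def norm_minus_commute)
  have cauchy: "sqint (\<lambda>x. fourier_L1 (s m) x - fourier_L1 (s n) x) \<le> ennreal (1 / 8 ^ n)" if "n \<le> m" for m n
  proof -
    have "sqint (\<lambda>x. fourier_L1 (s m) x - fourier_L1 (s n) x) = sqint (fourier_L1 (\<lambda>x. s m x - s n x))"
      by (simp add: fourier_L1_diff si sqint_def)
    also have "\<dots> \<le> sqint (\<lambda>x. s m x - s n x)"
      by (intro sqint_fourier_L1_le Bochner_Integration.integrable_diff si)
    also have "\<dots> = sqint (\<lambda>x. (s m x - f x) + (f x - s n x))" by simp
    also have "\<dots> \<le> 2 * sqint (\<lambda>x. s m x - f x) + 2 * sqint (\<lambda>x. f x - s n x)"
      by (rule sqint_add_le) measurable
    also have "\<dots> \<le> 2 * ennreal (1 / 4 / 8 ^ m) + 2 * ennreal (1 / 4 / 8 ^ n)"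
      by (intro add_mono mult_left_mono sf sf[unfolded sq_comm[of "s _" f]]) auto
    also have "\<dots> \<le> 2 * ennreal (1 / 4 / 8 ^ n) + 2 * ennreal (1 / 4 / 8 ^ n)"
      using that by (intro add_mono mult_left_mono ennreal_leI divide_left_mono power_increasing) auto
    also have "\<dots> = 4 * ennreal (1 / 4 / 8 ^ n)"
      by (simp flip: distrib_right)
    also have "\<dots> = ennreal (4 * (1 / 4 / 8 ^ n))"
      by (subst ennreal_mult) auto
    finally show ?thesis by simp
  qed
  have meas: "fourier_L1 (s n) \<in> borel_measurable borel" for n by (rule borel_measurable_fourier_L1) measurable
  obtain F where F: "F \<in> borel_measurable borel"
    and FN: "\<And>n. sqint (\<lambda>x. F x - fourier_L1 (s n) x) \<le> ennreal (1 / 8 ^ n)"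
    using L2_fast_Cauchy_limit[of "\<lambda>n. fourier_L1 (s n)" 1, OF meas zero_le_one cauchy] by blast
  have [measurable]: "F \<in> borel_measurable borel" by fact
  have D: "(\<lambda>x. F x - fourier_L1 (s n) x) \<in> L2" for n
    using FN[of n] by (auto simp: L2_iff intro: le_less_trans)
  have "F \<in> L2"
    using L2_add[OF D[of 0] fourier_L1_L2(1)[OF si[of 0] s2[of 0]]] by simp
  have e8: "(\<lambda>n. (1::real) / 8 ^ n) \<longlonglongrightarrow> 0"
    using LIMSEQ_realpow_zero[of "1 / 8 :: real"] by (simp add: power_divide)
  have "(\<lambda>n. L2_norm (\<lambda>x. s n x - f x)) \<longlonglongrightarrow> 0"
  proof (rule L2_norm_tendsto_0[OF _ e8])
    show "sqint (\<lambda>x. s n x - f x) \<le> ennreal (1 / 8 ^ n)" for n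
      using sf[of n] by (rule order_trans) (rule ennreal_leI, simp add: divide_simps)
  qed (auto intro: L2_diff s2 f)
  moreover have "(\<lambda>n. L2_norm (\<lambda>x. fourier_L1 (s n) x - F x)) \<longlonglongrightarrow> 0"
    unfolding L2_norm_minus_commute[of "fourier_L1 _"]
    by (rule L2_norm_tendsto_0[OF D e8 FN]) simp
  ultimately show ?thesis
    unfolding has_L2_fourier_def
    by (intro exI[of _ F] conjI f \<open>F \<in> L2\<close> exI[of _ s] allI si s2 fourier_L1_L2(1))
qed

lemma has_L2_fourier_fourier_L2: "f \<in> L2 \<Longrightarrow> has_L2_fourier f (fourier_L2 f)"
  unfolding fourier_L2_def using has_L2_fourier_ex by (rule someI_ex)

lemma has_L2_fourier_norm_le:
  assumes "has_L2_fourier f F"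
  shows "L2_norm F \<le> L2_norm f"
proof -
  from assms obtain s where f: "f \<in> L2" and F: "F \<in> L2"
    and s: "\<And>n. integrable lborel (s n)" "\<And>n. s n \<in> L2" "\<And>n. fourier_L1 (s n) \<in> L2"
    and lim: "(\<lambda>n. L2_norm (\<lambda>x. s n x - f x)) \<longlonglongrightarrow> 0" "(\<lambda>n::nat. L2_norm (\<lambda>w. fourier_L1 (s n) w - F w)) \<longlonglongrightarrow> 0"
    unfolding has_L2_fourier_def by blast
  have "(\<lambda>n. L2_norm (\<lambda>w. fourier_L1 (s n) w - F w) + (L2_norm (\<lambda>x. s n x - f x) + L2_norm f)) \<longlonglongrightarrow> 0 + (0 + L2_norm f)"
    by (intro tendsto_intros lim)
  moreover have "L2_norm F \<le> L2_norm (\<lambda>w. fourier_L1 (s n) w - F w) + (L2_norm (\<lambda>x. s n x - f x) + L2_norm f)" for n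
  proof -
    have "L2_norm F \<le> L2_norm (\<lambda>w. F w - fourier_L1 (s n) w) + L2_norm (fourier_L1 (s n))"
      using L2_norm_triangle[OF L2_diff[OF F s(3)] s(3), of n n] by simp
    also have "L2_norm (fourier_L1 (s n)) \<le> L2_norm (s n)"
      by (rule fourier_L1_L2(2)) (rule s)+
    also have "L2_norm (s n) \<le> L2_norm (\<lambda>x. s n x - f x) + L2_norm f"
      using L2_norm_triangle[OF L2_diff[OF s(2) f] f, of n] by simp
    finally show ?thesis
      by (simp add: L2_norm_minus_commute[of F])
  qed
  ultimately have "L2_norm F \<le> 0 + (0 + L2_norm f)"
    by (rule LIMSEQ_le_const[OF _ exI, OF _ allI, OF _ impI])
  then show ?thesis by simp
qed

section \<open>Gaussians as test functions for the L^2 transform\<close>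

lemma gaussian_wave_L2: "gaussian_wave z \<in> L2"
proof -
  define C where "C = exp ((Im z)\<^sup>2 / 2)"
  have le: "cmod (gaussian_wave z w) \<le> C" for w
  proof -
    have "sqrt (2 * pi) * normal_density (Im z) 1 w \<le> 1"
      by (simp add: normal_density_def)
    then have "C * (sqrt (2 * pi) * normal_density (Im z) 1 w) \<le> C * 1"
      by (intro mult_left_mono) (auto simp: C_def)
    then show ?thesis by (simp add: norm_gaussian_wave C_def mult.assoc)
  qed
  have "integrable lborel (\<lambda>w. (cmod (gaussian_wave z w))\<^sup>2)"
  proof (rule Bochner_Integration.integrable_bound)
    show "integrable lborel (\<lambda>w. C * cmod (gaussian_wave z w))"
      by (intro integrable_mult_right integrable_norm integrable_gaussian_wave)
    show "AE w in lborel. norm ((cmod (gaussian_wave z w))\<^sup>2) \<le> norm (C * cmod (gaussian_wave z w))"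
      by (rule AE_I2) (auto simp: power2_eq_square abs_mult intro!: mult_right_mono order_trans[OF le])
  qed measurable
  then show ?thesis by (simp add: L2_def)
qed

text \<open>Transforming a wave yields a Gaussian translated by a complex number. This identity
  shows it to be a multiple of a wave again, so transforms can be tested repeatedly within one
  family.\<close>

lemma gaussian_shift_eq:
  "exp (- (complex_of_real x + z)\<^sup>2 / 2) = exp (- z\<^sup>2 / 2) * gaussian_wave (- \<i> * z) x"
  unfolding gaussian_wave_def mult_exp_exp
  by (rule arg_cong[of _ _ exp]) (simp add: field_simps power2_eq_square)

lemma gaussian_shift_L2: "(\<lambda>x. exp (- (complex_of_real x + z)\<^sup>2 / 2)) \<in> L2"
  unfolding gaussian_shift_eq by (intro L2_cmult gaussian_wave_L2)

lemma fourier_gaussian_wave: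
  "(LINT w|lborel. gaussian_wave z w * exp (- (\<i> * complex_of_real w * complex_of_real x)))
    = sqrt (2 * pi) * exp (- (complex_of_real x + z)\<^sup>2 / 2)"
proof -
  have "gaussian_wave z w * exp (- (\<i> * complex_of_real w * complex_of_real x)) = gaussian_wave (complex_of_real x + z) w" for w
    unfolding gaussian_wave_def mult_exp_exp
    by (rule arg_cong[of _ _ exp]) (simp add: field_simps)
  then show ?thesis by (simp add: integral_gaussian_wave)
qed

lemma fourier_L1_gaussian_wave:
  assumes s: "integrable lborel s"
  shows "(LINT w|lborel. fourier_L1 s w * gaussian_wave z w) = (LINT x|lborel. s x * exp (- (complex_of_real x + z)\<^sup>2 / 2))"
proof -
  have k: "(\<lambda>(x::real, w::real). exp (- (\<i> * complex_of_real w * complex_of_real x))) \<in> borel_measurable (borel \<Otimes>\<^sub>M borel)"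
    by measurable
  have "(LINT w|lborel. fourier_L1 s w * gaussian_wave z w)
     = 1 / sqrt (2 * pi) * (LINT w|lborel. (LINT x|lborel. s x * exp (- (\<i> * complex_of_real w * complex_of_real x))) * gaussian_wave z w)"
    by (simp add: fourier_L1_def)
  also have "(LINT w|lborel. (LINT x|lborel. s x * exp (- (\<i> * complex_of_real w * complex_of_real x))) * gaussian_wave z w)
    = (LINT x|lborel. s x * (sqrt (2 * pi) * exp (- (complex_of_real x + z)\<^sup>2 / 2)))"
    unfolding fourier_gaussian_wave[symmetric]
    by (rule integral_kernel_swap[OF s integrable_gaussian_wave, where k="\<lambda>x w. exp (- (\<i> * complex_of_real w * complex_of_real x))"])
       (use k in auto)
  also have "\<dots> = (LINT x|lborel. sqrt (2 * pi) * (s x * exp (- (complex_of_real x + z)\<^sup>2 / 2)))"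
    by (simp add: mult_ac)
  also have "\<dots> = sqrt (2 * pi) * (LINT x|lborel. s x * exp (- (complex_of_real x + z)\<^sup>2 / 2))"
    by (rule integral_mult_right_zero)
  finally show ?thesis by simp
qed

text \<open>Both sides are continuous in L^2, so the formula for integrable functions passes to the
  limit. It holds for every representative \<open>F\<close>, whatever the choice operator selects,
  and takes the place of an inversion formula.\<close>

lemma has_L2_fourier_gaussian_wave:
  assumes "has_L2_fourier f F"
  shows "(LINT w|lborel. F w * gaussian_wave z w) = (LINT x|lborel. f x * exp (- (complex_of_real x + z)\<^sup>2 / 2))"
proof -
  from assms obtain s where f: "f \<in> L2" and F: "F \<in> L2"
    and s: "\<And>n. integrable lborel (s n)" "\<And>n. s n \<in> L2" "\<And>n. fourier_L1 (s n) \<in> L2"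
    and lim: "(\<lambda>n. L2_norm (\<lambda>x. s n x - f x)) \<longlonglongrightarrow> 0" "(\<lambda>n::nat. L2_norm (\<lambda>w. fourier_L1 (s n) w - F w)) \<longlonglongrightarrow> 0"
    unfolding has_L2_fourier_def by blast
  have "(\<lambda>n. LINT w|lborel. fourier_L1 (s n) w * gaussian_wave z w) \<longlonglongrightarrow> (LINT w|lborel. F w * gaussian_wave z w)"
    by (rule tendsto_integral_mult_L2[OF s(3) F gaussian_wave_L2 lim(2)])
  moreover have "(\<lambda>n. LINT w|lborel. fourier_L1 (s n) w * gaussian_wave z w) \<longlonglongrightarrow> (LINT x|lborel. f x * exp (- (complex_of_real x + z)\<^sup>2 / 2))"
    unfolding fourier_L1_gaussian_wave[OF s(1)]
    by (rule tendsto_integral_mult_L2[OF s(2) f gaussian_shift_L2 lim(1)])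
  ultimately show ?thesis by (rule LIMSEQ_unique)
qed

section \<open>Paley--Wiener functions\<close>

text \<open>The complement of the support is an arbitrary union of open sets; Lindelof's theorem
  reduces it to a countable one, so the exceptional null sets can be combined.\<close>

lemma AE_zero_outside_ess_supp: "AE x in lborel. x \<notin> ess_supp F \<longrightarrow> F x = 0"
proof -
  let ?U = "{U. open U \<and> (AE x in lborel. x \<in> U \<longrightarrow> F x = 0)}"
  obtain V where V: "V \<subseteq> ?U" "countable V" "\<Union>V = \<Union>?U"
    by (rule Lindelof[of ?U]) auto
  have "AE x in lborel. \<forall>U\<in>V. x \<in> U \<longrightarrow> F x = 0"
    using V by (subst AE_ball_countable) auto
  then show ?thesis
    by eventually_elim (use V(3) in \<open>unfold ess_supp_def, blast\<close>)
qed

lemma AE_zero_continuous: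
  fixes h :: "real \<Rightarrow> 'a::real_normed_vector"
  assumes cont: "continuous_on UNIV h" and ae: "AE x in lborel. h x = 0"
  shows "h x = 0"
proof (rule ccontr)
  assume "h x \<noteq> 0"
  have "open (h -` (- {0}))"
    using cont by (intro open_vimage) auto
  then obtain e where e: "e > 0" "ball x e \<subseteq> h -` (- {0})"
    using \<open>h x \<noteq> 0\<close> by (auto elim!: openE)
  have "AE y in lborel. y \<notin> {x - e<..<x + e}"
    using ae by eventually_elim (use e in \<open>auto simp: subset_iff dist_real_def\<close>)
  then have "emeasure lborel {x - e<..<x + e} = 0"
    by (subst (asm) AE_iff_measurable[of "{x - e<..<x + e}"]) auto
  then show False using e by simp
qed

text \<open>Expand the exponential. On the support |w| is bounded, so the moments of
  \<open>G\<close> grow at most geometrically, and termwise integration yields a power series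
  converging for every \<open>z\<close>.\<close>

lemma holomorphic_band_limited:
  fixes G :: "real \<Rightarrow> complex"
  assumes G: "integrable lborel G" and supp: "\<And>w. \<bar>w\<bar> > L \<Longrightarrow> G w = 0"
  shows "(\<lambda>z. LINT w|lborel. G w * exp (\<i> * complex_of_real w * z)) holomorphic_on UNIV"
proof -
  have [measurable]: "G \<in> borel_measurable borel" using G by auto
  define c where "c = (\<lambda>n. LINT w|lborel. G w * (\<i> * complex_of_real w) ^ n / fact n)"
  have sums: "(\<lambda>n. c n * z ^ n) sums (LINT w|lborel. G w * exp (\<i> * complex_of_real w * z))" for z
  proof -
    define u where "u = (\<lambda>n w. G w * (\<i> * complex_of_real w * z) ^ n / fact n)"
    \<comment> \<open>\<open>\<bar>L\<bar>\<close> keeps the bound nonnegative; for negative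
      \<open>L\<close> the support condition forces \<open>G\<close> to vanish.\<close>
    have le: "norm (u n w) \<le> norm (G w) * ((\<bar>L\<bar> * cmod z) ^ n / fact n)" for n w
    proof (cases "\<bar>w\<bar> > L")
      case False
      then have "(\<bar>w\<bar> * cmod z) ^ n / fact n \<le> (\<bar>L\<bar> * cmod z) ^ n / fact n"
        by (intro divide_right_mono power_mono mult_right_mono) auto
      from mult_left_mono[OF this norm_ge_zero[of "G w"]]
      show ?thesis by (simp add: u_def norm_mult norm_divide norm_power)
    qed (simp add: u_def supp)
    have "summable (\<lambda>n. (\<bar>L\<bar> * cmod z) ^ n /\<^sub>R fact n)"
      by (rule summable_exp_generic)
    then have sm: "summable (\<lambda>n. C * ((\<bar>L\<bar> * cmod z) ^ n / fact n))" for C :: real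
      by (intro summable_mult) (simp add: divide_inverse mult.commute)
    have iu: "integrable lborel (u n)" for n
    proof (rule Bochner_Integration.integrable_bound)
      show "integrable lborel (\<lambda>w. norm (G w) * ((\<bar>L\<bar> * cmod z) ^ n / fact n))"
        using G by (intro integrable_mult_left integrable_norm)
      show "u n \<in> borel_measurable lborel" unfolding u_def by measurable
    qed (use le in auto)
    have "(\<lambda>n. LINT w|lborel. u n w) sums (LINT w|lborel. (\<Sum>n. u n w))"
    proof (rule sums_integral[OF iu])
      show "AE w in lborel. summable (\<lambda>n. norm (u n w))"
        by (rule AE_I2, rule summable_comparison_test'[OF sm, where N=0]) (use le in simp)
      show "summable (\<lambda>n. LINT w|lborel. norm (u n w))"
      proof (rule summable_comparison_test'[OF sm, where N=0])
        fix n
        have "(LINT w|lborel. norm (u n w)) \<le> (LINT w|lborel. norm (G w) * ((\<bar>L\<bar> * cmod z) ^ n / fact n))"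
          using G by (intro integral_mono integrable_norm iu integrable_mult_left le)
        then show "norm (LINT w|lborel. norm (u n w)) \<le> (LINT w|lborel. norm (G w)) * ((\<bar>L\<bar> * cmod z) ^ n / fact n)"
          by simp
      qed
    qed
    moreover have "(LINT w|lborel. u n w) = c n * z ^ n" for n
    proof -
      have "u n w = z ^ n * (G w * (\<i> * complex_of_real w) ^ n / fact n)" for w
        by (simp add: u_def power_mult_distrib)
      then show ?thesis unfolding c_def by (simp add: mult.commute[of _ "z ^ n"])
    qed
    moreover have "(\<Sum>n. u n w) = G w * exp (\<i> * complex_of_real w * z)" for w
    proof -
      have "(\<lambda>n. G w * ((\<i> * complex_of_real w * z) ^ n /\<^sub>R fact n)) sums (G w * exp (\<i> * complex_of_real w * z))"
        by (intro sums_mult exp_converges)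
      then show ?thesis
        by (intro sums_unique[symmetric]) (simp add: u_def scaleR_conv_of_real divide_inverse mult_ac)
    qed
    ultimately show ?thesis by simp
  qed
  have "(\<lambda>z. LINT w|lborel. G w * exp (\<i> * complex_of_real w * z)) holomorphic_on ball 0 r" for r
    by (rule power_series_holomorphic[where a=c]) (use sums in simp)
  then have "(\<lambda>z. LINT w|lborel. G w * exp (\<i> * complex_of_real w * z)) field_differentiable at z" for z
    using holomorphic_on_imp_differentiable_at[of _ "ball 0 (cmod z + 1)" z] by (auto simp: dist_norm)
  then show ?thesis by (simp add: holomorphic_on_def)
qed

lemma norm_band_limited_le:
  fixes G :: "real \<Rightarrow> complex"
  assumes G: "integrable lborel G" and supp: "\<And>w. \<bar>w\<bar> > L \<Longrightarrow> G w = 0"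
  shows "cmod (LINT w|lborel. G w * exp (\<i> * complex_of_real w * z)) \<le> (LINT w|lborel. cmod (G w)) * exp (L * \<bar>Im z\<bar>)"
proof -
  have [measurable]: "G \<in> borel_measurable borel" using G by auto
  have le: "cmod (G w * exp (\<i> * complex_of_real w * z)) \<le> cmod (G w) * exp (L * \<bar>Im z\<bar>)" for w
  proof (cases "\<bar>w\<bar> > L")
    case False
    then have "\<bar>w\<bar> * \<bar>Im z\<bar> \<le> L * \<bar>Im z\<bar>" by (intro mult_right_mono) auto
    then have "- (w * Im z) \<le> L * \<bar>Im z\<bar>"
      using abs_ge_minus_self[of "w * Im z"] by (simp add: abs_mult)
    then show ?thesis by (simp add: norm_mult mult_left_mono)
  qed (simp add: supp)
  have i2: "integrable lborel (\<lambda>w. cmod (G w) * exp (L * \<bar>Im z\<bar>))" using G by simp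
  have "integrable lborel (\<lambda>w. G w * exp (\<i> * complex_of_real w * z))"
    by (rule Bochner_Integration.integrable_bound[OF i2]) (use le in auto)
  then have "(LINT w|lborel. cmod (G w * exp (\<i> * complex_of_real w * z))) \<le> (LINT w|lborel. cmod (G w) * exp (L * \<bar>Im z\<bar>))"
    by (intro integral_mono integrable_norm i2 le)
  then show ?thesis
    by (intro order_trans[OF integral_norm_bound]) simp
qed

text \<open>Conjugation converts the inverse transform into a forward one: at height
  \<open>y\<close> the integral is the conjugate of the transform of \<open>K\<close>, to which the
  contraction inequality applies. The support turns the weight in \<open>K\<close> into the factor
  \<open>exp (L * \<bar>y\<bar>)\<close>.\<close>

lemma sqint_band_limited_le:
  fixes G :: "real \<Rightarrow> complex"
  assumes G: "integrable lborel G" and supp: "\<And>w. \<bar>w\<bar> > L \<Longrightarrow> G w = 0"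
  shows "sqint (\<lambda>x. 1 / sqrt (2 * pi) * (LINT w|lborel. G w * exp (\<i> * complex_of_real w * Complex x y)))
    \<le> ennreal (exp (2 * L * \<bar>y\<bar>)) * sqint G"
proof -
  have [measurable]: "G \<in> borel_measurable borel" using G by auto
  define K where "K = (\<lambda>w. cnj (G w * complex_of_real (exp (- w * y))))"
  have le: "cmod (K w) \<le> cmod (complex_of_real (exp (L * \<bar>y\<bar>)) * G w)" for w
  proof (cases "\<bar>w\<bar> > L")
    case False
    then have "\<bar>w\<bar> * \<bar>y\<bar> \<le> L * \<bar>y\<bar>" by (intro mult_right_mono) auto
    then have "- (w * y) \<le> L * \<bar>y\<bar>"
      using abs_ge_minus_self[of "w * y"] by (simp add: abs_mult)
    then have "exp (- (w * y)) * cmod (G w) \<le> exp (L * \<bar>y\<bar>) * cmod (G w)" by (intro mult_right_mono) auto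
    then show ?thesis by (simp add: K_def norm_mult mult.commute)
  qed (simp add: K_def supp)
  have iK: "integrable lborel K"
  proof (rule Bochner_Integration.integrable_bound)
    show "integrable lborel (\<lambda>w. complex_of_real (exp (L * \<bar>y\<bar>)) * G w)" using G by simp
    show "K \<in> borel_measurable lborel" unfolding K_def by measurable
  qed (use le in auto)
  have "1 / sqrt (2 * pi) * (LINT w|lborel. G w * exp (\<i> * complex_of_real w * Complex x y)) = cnj (fourier_L1 K x)" for x
  proof -
    have "cnj (G w * exp (\<i> * complex_of_real w * Complex x y)) = K w * exp (- (\<i> * complex_of_real x * complex_of_real w))" for w
    proof -
      have "cnj (exp (\<i> * complex_of_real w * Complex x y)) = complex_of_real (exp (- w * y)) * exp (- (\<i> * complex_of_real x * complex_of_real w))"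
        unfolding exp_cnj exp_of_real[symmetric] mult_exp_exp
        by (rule arg_cong[of _ _ exp]) (simp add: complex_eq_iff)
      then show ?thesis by (simp add: K_def)
    qed
    then have *: "cnj (LINT w|lborel. G w * exp (\<i> * complex_of_real w * Complex x y)) = (LINT w|lborel. K w * exp (- (\<i> * complex_of_real x * complex_of_real w)))"
      unfolding Bochner_Integration.integral_cnj[symmetric] by simp
    show ?thesis unfolding fourier_L1_def *[symmetric] by simp
  qed
  then have "sqint (\<lambda>x. 1 / sqrt (2 * pi) * (LINT w|lborel. G w * exp (\<i> * complex_of_real w * Complex x y))) = sqint (fourier_L1 K)"
    by (simp add: sqint_def)
  also have "\<dots> \<le> sqint K" by (rule sqint_fourier_L1_le[OF iK])
  also have "\<dots> \<le> sqint (\<lambda>w. complex_of_real (exp (L * \<bar>y\<bar>)) * G w)" by (rule sqint_mono[OF le])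
  also have "\<dots> = ennreal (exp (2 * L * \<bar>y\<bar>)) * sqint G"
    by (subst sqint_cmult) (simp_all add: power2_eq_square mult.assoc flip: exp_add)
  finally show ?thesis .
qed

text \<open>Testing both sides against Gaussians shows that their difference, multiplied by a Gaussian,
  has vanishing Fourier transform.\<close>

lemma PW_representation:
  assumes f: "f \<in> PW L"
  obtains G where "G \<in> L2" "integrable lborel G" "\<And>w. \<bar>w\<bar> > L \<Longrightarrow> G w = 0" "L2_norm G \<le> PW_norm f"
    "\<And>z. f z = 1 / sqrt (2 * pi) * (LINT w|lborel. G w * exp (\<i> * complex_of_real w * z))"
proof -
  define r where "r = on_reals f"
  have hol: "f holomorphic_on UNIV" and r2: "r \<in> L2" and supp: "ess_supp (fourier_L2 r) \<subseteq> {-L..L}"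
    using f by (auto simp: PW_def r_def)
  define F where "F = fourier_L2 r"
  have four: "has_L2_fourier r F" unfolding F_def by (rule has_L2_fourier_fourier_L2[OF r2])
  then have F2: "F \<in> L2" by (simp add: has_L2_fourier_def)
  then have [measurable]: "F \<in> borel_measurable borel" by (rule L2_measurable)
  \<comment> \<open>Cutting off alters the chosen representative only on a null set, but makes the
    support condition hold pointwise and \<open>G\<close> integrable.\<close>
  define G where "G = (\<lambda>w. indicator {-L..L} w * F w)"
  have G2: "G \<in> L2" by (rule L2_bound[OF F2]) (auto simp: G_def indicator_def)
  have [measurable]: "G \<in> borel_measurable borel" using G2 by (rule L2_measurable)
  have G1: "integrable lborel G" unfolding G_def by (rule L2_truncation_integrable[OF F2])
  have GL: "G w = 0" if "\<bar>w\<bar> > L" for w using that by (auto simp: G_def indicator_def)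
  have FG: "AE w in lborel. F w = G w"
    using AE_zero_outside_ess_supp[of F]
    by eventually_elim (use supp in \<open>auto simp: G_def F_def indicator_def\<close>)
  have "L2_norm G = L2_norm F"
    unfolding L2_norm_def using FG
    by (intro arg_cong[of _ _ sqrt] integral_cong_AE) auto
  then have Gn: "L2_norm G \<le> PW_norm f"
    using has_L2_fourier_norm_le[OF four] by (simp add: PW_norm_def r_def)
  have G_weak: "(LINT w|lborel. G w * gaussian_wave z w) = (LINT x|lborel. r x * exp (- (complex_of_real x + z)\<^sup>2 / 2))" for z
    unfolding has_L2_fourier_gaussian_wave[OF four, symmetric]
    using FG by (intro integral_cong_AE) auto
  \<comment> \<open>The candidate for \<open>f\<close>: the inverse transform of \<open>G\<close>,
    entire by band limitation and bounded on the real line.\<close>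
  define q where "q = (\<lambda>z. 1 / sqrt (2 * pi) * (LINT w|lborel. G w * exp (\<i> * complex_of_real w * z)))"
  have holq: "q holomorphic_on UNIV"
    unfolding q_def by (intro holomorphic_intros holomorphic_band_limited[OF G1]) (rule GL)
  have cont: "continuous_on UNIV (\<lambda>x. h (complex_of_real x))" if "h holomorphic_on UNIV" for h :: "complex \<Rightarrow> complex"
    using holomorphic_on_imp_continuous_on[OF that]
    by (rule continuous_on_compose2) (auto intro: continuous_intros)
  have [measurable]: "(\<lambda>x. q (complex_of_real x)) \<in> borel_measurable borel"
    by (intro borel_measurable_continuous_onI cont holq)
  have [measurable]: "r \<in> borel_measurable borel" using r2 by (rule L2_measurable)
  define B where "B = cmod (1 / sqrt (2 * pi)) * (LINT w|lborel. cmod (G w))"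
  have qB: "cmod (q (complex_of_real x)) \<le> B" for x
  proof -
    have "cmod (LINT w|lborel. G w * exp (\<i> * complex_of_real w * complex_of_real x)) \<le> (LINT w|lborel. cmod (G w)) * exp (L * \<bar>Im (complex_of_real x)\<bar>)"
      by (rule norm_band_limited_le[OF G1]) (rule GL)
    then show ?thesis unfolding q_def B_def norm_mult[of "complex_of_real (1 / sqrt (2 * pi))"]
      by (intro mult_left_mono) auto
  qed
  have iq: "integrable lborel (\<lambda>x. q (complex_of_real x) * gaussian_wave z x)" for z
  proof (rule Bochner_Integration.integrable_bound)
    show "integrable lborel (\<lambda>x. complex_of_real B * gaussian_wave z x)"
      by (intro integrable_mult_right integrable_gaussian_wave)
    show "AE x in lborel. norm (q (complex_of_real x) * gaussian_wave z x) \<le> norm (complex_of_real B * gaussian_wave z x)"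
      by (rule AE_I2) (auto simp: norm_mult intro!: mult_right_mono order_trans[OF qB])
  qed measurable
  have ir: "integrable lborel (\<lambda>x. r x * gaussian_wave z x)" for z
    by (rule L2_mult_integrable[OF r2 gaussian_wave_L2])
  \<comment> \<open>The difference of an L^2 function and a bounded one need not be integrable; the
    Gaussian factor makes it so, and having no zeros it can be cancelled at the end.\<close>
  define H where "H = (\<lambda>x. (r x - q (complex_of_real x)) * gaussian_wave 0 x)"
  have gw_mult: "gaussian_wave z x * exp (\<i> * complex_of_real t * complex_of_real x) = gaussian_wave (z - complex_of_real t) x" for z and t x :: real
    unfolding gaussian_wave_def mult_exp_exp by (rule arg_cong[of _ _ exp]) (simp add: field_simps)
  have "AE x in lborel. H x = 0"
  proof (rule L1_fourier_unique)
    show "integrable lborel H"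
      using Bochner_Integration.integrable_diff[OF ir[of 0] iq[of 0]] by (simp add: H_def left_diff_distrib)
    fix t
    have "H x * iexp (t * x) = r x * gaussian_wave (- complex_of_real t) x - q (complex_of_real x) * gaussian_wave (- complex_of_real t) x" for x
      using gw_mult[of 0 x t] by (simp add: H_def algebra_simps)
    then have "(LINT x|lborel. H x * iexp (t * x)) = (LINT x|lborel. r x * gaussian_wave (- complex_of_real t) x) - (LINT x|lborel. q (complex_of_real x) * gaussian_wave (- complex_of_real t) x)"
      using ir iq by simp
    also have "(LINT x|lborel. q (complex_of_real x) * gaussian_wave (- complex_of_real t) x)
      = 1 / sqrt (2 * pi) * (LINT x|lborel. (LINT w|lborel. G w * exp (\<i> * complex_of_real w * complex_of_real x)) * gaussian_wave (- complex_of_real t) x)"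
      unfolding q_def mult.assoc by (rule integral_mult_right_zero)
    also have "(LINT x|lborel. (LINT w|lborel. G w * exp (\<i> * complex_of_real w * complex_of_real x)) * gaussian_wave (- complex_of_real t) x)
      = (LINT w|lborel. G w * (LINT x|lborel. gaussian_wave (- complex_of_real t) x * exp (\<i> * complex_of_real w * complex_of_real x)))"
      by (rule integral_kernel_swap[OF G1 integrable_gaussian_wave, where k="\<lambda>w x. exp (\<i> * complex_of_real w * complex_of_real x)"]) auto
    also have "\<dots> = (LINT w|lborel. sqrt (2 * pi) * (G w * exp (- (complex_of_real (t + w))\<^sup>2 / 2)))"
    proof (intro Bochner_Integration.integral_cong refl)
      fix w
      have "(- complex_of_real t - complex_of_real w)\<^sup>2 = (complex_of_real (t + w))\<^sup>2"
        by (simp add: power2_eq_square algebra_simps)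
      then show "G w * (LINT x|lborel. gaussian_wave (- complex_of_real t) x * exp (\<i> * complex_of_real w * complex_of_real x))
        = sqrt (2 * pi) * (G w * exp (- (complex_of_real (t + w))\<^sup>2 / 2))"
        unfolding gw_mult integral_gaussian_wave by simp
    qed
    also have "\<dots> = sqrt (2 * pi) * (LINT w|lborel. G w * exp (- (complex_of_real (t + w))\<^sup>2 / 2))"
      by (rule integral_mult_right_zero)
    also have "1 / sqrt (2 * pi) * (sqrt (2 * pi) * (LINT w|lborel. G w * exp (- (complex_of_real (t + w))\<^sup>2 / 2)))
       = (LINT w|lborel. G w * exp (- (complex_of_real (t + w))\<^sup>2 / 2))"
      by simp
    also have "(LINT w|lborel. G w * exp (- (complex_of_real (t + w))\<^sup>2 / 2))
       = (LINT w|lborel. exp (- (complex_of_real t)\<^sup>2 / 2) * (G w * gaussian_wave (- \<i> * complex_of_real t) w))"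
    proof (intro Bochner_Integration.integral_cong refl)
      fix w
      show "G w * exp (- (complex_of_real (t + w))\<^sup>2 / 2) = exp (- (complex_of_real t)\<^sup>2 / 2) * (G w * gaussian_wave (- \<i> * complex_of_real t) w)"
        using gaussian_shift_eq[of w "complex_of_real t"] by (simp add: add.commute)
    qed
    also have "\<dots> = exp (- (complex_of_real t)\<^sup>2 / 2) * (LINT w|lborel. G w * gaussian_wave (- \<i> * complex_of_real t) w)"
      by (rule integral_mult_right_zero)
    \<comment> \<open>\<open>G_weak\<close> at the imaginary parameter \<open>- \<i> * t\<close>
      leads back from \<open>G\<close> to \<open>r\<close>. The two completions of the square leave
      factors exp(-t^2/2) and exp(t^2/2), which cancel.\<close>
    also have "\<dots> = exp (- (complex_of_real t)\<^sup>2 / 2) * (LINT x|lborel. r x * exp (- (complex_of_real x - \<i> * complex_of_real t)\<^sup>2 / 2))"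
      unfolding G_weak by simp
    also have "(LINT x|lborel. r x * exp (- (complex_of_real x - \<i> * complex_of_real t)\<^sup>2 / 2))
      = (LINT x|lborel. exp ((complex_of_real t)\<^sup>2 / 2) * (r x * gaussian_wave (- complex_of_real t) x))"
    proof (intro Bochner_Integration.integral_cong refl)
      fix x
      show "r x * exp (- (complex_of_real x - \<i> * complex_of_real t)\<^sup>2 / 2) = exp ((complex_of_real t)\<^sup>2 / 2) * (r x * gaussian_wave (- complex_of_real t) x)"
        using gaussian_shift_eq[of x "- \<i> * complex_of_real t"] by (simp add: power_mult_distrib)
    qed
    also have "\<dots> = exp ((complex_of_real t)\<^sup>2 / 2) * (LINT x|lborel. r x * gaussian_wave (- complex_of_real t) x)"
      by (rule integral_mult_right_zero)
    finally show "(LINT x|lborel. H x * iexp (t * x)) = 0"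
      by (simp add: mult.assoc[symmetric] mult_exp_exp)
  qed
  then have "AE x in lborel. f (complex_of_real x) - q (complex_of_real x) = 0"
    by eventually_elim (simp add: H_def r_def on_reals_def gaussian_wave_def)
  then have real: "f (complex_of_real x) - q (complex_of_real x) = 0" for x
    by (rule AE_zero_continuous[rotated]) (intro continuous_intros cont hol holq)
  have "f z - q z = 0" for z
  \<comment> \<open>The real line has 0 as a limit point, so agreement of the two entire functions
    there extends to the whole plane.\<close>
  proof (rule analytic_continuation[of "\<lambda>z. f z - q z" UNIV \<real> 0])
    show "(\<lambda>z. f z - q z) holomorphic_on UNIV" by (intro holomorphic_intros hol holq)
    show "(0::complex) islimpt \<real>"
      unfolding islimpt_approachable
    proof (intro allI impI)
      fix e :: real assume "e > 0"
      then show "\<exists>x'\<in>\<real>. x' \<noteq> 0 \<and> dist x' (0::complex) < e"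
        by (intro bexI[of _ "complex_of_real (e / 2)"]) auto
    qed
    show "f z - q z = 0" if "z \<in> \<real>" for z using that real by (auto elim: Reals_cases)
  qed auto
  then have "f z = 1 / sqrt (2 * pi) * (LINT w|lborel. G w * exp (\<i> * complex_of_real w * z))" for z
    by (simp add: q_def)
  then show thesis
    by (intro that[of G] G2 G1 GL Gn)
qed

text \<open>Uniform boundedness on horizontal strips is what lets a Gaussian factor suppress the
  vertical sides when the contour is moved.\<close>

lemma PW_bounded_on_strip:
  assumes f: "f \<in> PW L"
  obtains B where "\<And>z. cmod (f z) \<le> B * exp (L * \<bar>Im z\<bar>)"
proof (rule PW_representation[OF f])
  fix G
  assume G: "integrable lborel G" "\<And>w. \<bar>w\<bar> > L \<Longrightarrow> G w = 0"
    and fz: "\<And>z. f z = 1 / sqrt (2 * pi) * (LINT w|lborel. G w * exp (\<i> * complex_of_real w * z))"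
  show thesis
  proof
    fix z
    have "cmod (f z) = cmod (complex_of_real (1 / sqrt (2 * pi))) * cmod (LINT w|lborel. G w * exp (\<i> * complex_of_real w * z))"
      unfolding fz by (rule norm_mult)
    also have "\<dots> \<le> cmod (complex_of_real (1 / sqrt (2 * pi))) * ((LINT w|lborel. cmod (G w)) * exp (L * \<bar>Im z\<bar>))"
      by (intro mult_left_mono norm_band_limited_le G) auto
    finally show "cmod (f z) \<le> (cmod (complex_of_real (1 / sqrt (2 * pi))) * (LINT w|lborel. cmod (G w))) * exp (L * \<bar>Im z\<bar>)"
      by (simp only: mult.assoc)
  qed
qed

lemma PW_sqint_le:
  assumes f: "f \<in> PW L"
  shows "sqint (\<lambda>x. f (Complex x y)) \<le> ennreal (exp (2 * L * \<bar>y\<bar>) * (PW_norm f)\<^sup>2)"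
proof (rule PW_representation[OF f])
  fix G
  assume G: "G \<in> L2" "integrable lborel G" "\<And>w. \<bar>w\<bar> > L \<Longrightarrow> G w = 0" "L2_norm G \<le> PW_norm f"
    and fz: "\<And>z. f z = 1 / sqrt (2 * pi) * (LINT w|lborel. G w * exp (\<i> * complex_of_real w * z))"
  have "sqint (\<lambda>x. f (Complex x y)) \<le> ennreal (exp (2 * L * \<bar>y\<bar>)) * sqint G"
    unfolding fz by (rule sqint_band_limited_le[OF G(2,3)])
  also have "\<dots> \<le> ennreal (exp (2 * L * \<bar>y\<bar>)) * ennreal ((PW_norm f)\<^sup>2)"
    unfolding sqint_eq_L2_norm[OF G(1)] by (intro mult_left_mono ennreal_leI power_mono G(4)) auto
  finally show ?thesis by (simp add: ennreal_mult)
qed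

text \<open>The norm sees only real points, but if it is 0 then \<open>G\<close> vanishes almost
  everywhere, and the representation makes \<open>f\<close> vanish off the real line too.\<close>

lemma PW_norm_eq_0D:
  assumes f: "f \<in> PW L" and "PW_norm f = 0"
  shows "f z = 0"
proof (rule PW_representation[OF f])
  fix G
  assume G: "G \<in> L2" "L2_norm G \<le> PW_norm f"
    and fz: "\<And>z. f z = 1 / sqrt (2 * pi) * (LINT w|lborel. G w * exp (\<i> * complex_of_real w * z))"
  have "L2_norm G = 0"
    using G(2) assms(2) L2_norm_nonneg[of G] by simp
  then have "(LINT w|lborel. (cmod (G w))\<^sup>2) = 0"
    by (simp add: L2_norm_def)
  then have "AE w in lborel. (cmod (G w))\<^sup>2 = 0"
    using integral_nonneg_eq_0_iff_AE[OF L2_integrable[OF G(1)]] by simp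
  then have "AE w in lborel. G w * exp (\<i> * complex_of_real w * z) = 0"
    by eventually_elim simp
  then show ?thesis unfolding fz by (simp add: integral_eq_zero_AE)
qed

section \<open>Functions on a strip\<close>

lemma open_strip: "open (strip m)"
  unfolding strip_def by (intro open_Collect_less continuous_intros)

lemma convex_strip: "convex (strip m)"
proof -
  have "strip m = {z. Im z < m} \<inter> {z. - m < Im z}"
    by (auto simp: strip_def)
  then show ?thesis
    using convex_Int[OF convex_halfspace_Im_lt convex_halfspace_Im_gt] by simp
qed

lemma tendsto_integral_symmetric_intervals:
  fixes h :: "real \<Rightarrow> complex"
  assumes h: "integrable lborel h"
  shows "(\<lambda>n. LINT x|lborel. indicator {- real n..real n} x *\<^sub>R h x) \<longlonglongrightarrow> (LINT x|lborel. h x)"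
proof (rule integral_dominated_convergence)
  have [measurable]: "h \<in> borel_measurable borel" using h by auto
  show "integrable lborel (\<lambda>x. norm (h x))" using h by (rule integrable_norm)
  show "AE x in lborel. (\<lambda>n. indicator {- real n..real n} x *\<^sub>R h x) \<longlonglongrightarrow> h x"
  proof (rule AE_I2, rule tendsto_eventually)
    fix x :: real
    obtain m where m: "\<bar>x\<bar> \<le> real m" using real_arch_simple by blast
    show "\<forall>\<^sub>F n in sequentially. indicator {- real n..real n} x *\<^sub>R h x = h x"
      using eventually_ge_at_top[of m] by eventually_elim (use m in \<open>auto simp: indicator_def\<close>)
  qed
  show "AE x in lborel. norm (indicator {- real n..real n} x *\<^sub>R h x) \<le> norm (h x)" for n
    by (rule AE_I2) (auto simp: indicator_def)
  show "(\<lambda>x. indicator {- real n..real n} x *\<^sub>R h x) \<in> borel_measurable lborel" for n by measurable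
qed (use h in auto)

text \<open>Cauchy's theorem for rectangles, expressed by a primitive \<open>P\<close> on the convex
  strip: integrals over corresponding pieces of the two lines differ only by increments of
  \<open>P\<close> along the vertical sides, each at most \<open>b x * \<bar>y\<bar>\<close> in
  modulus.\<close>

lemma integral_strip_shift:
  assumes K: "K holomorphic_on strip m" and y: "\<bar>y\<bar> < m"
    and bound: "\<And>z. \<bar>Im z\<bar> \<le> \<bar>y\<bar> \<Longrightarrow> cmod (K z) \<le> b (Re z)"
    and b: "(\<lambda>n. b (real n)) \<longlonglongrightarrow> 0" "(\<lambda>n. b (- real n)) \<longlonglongrightarrow> 0"
    and int: "integrable lborel (\<lambda>x. K (Complex x 0))" "integrable lborel (\<lambda>x. K (Complex x y))"
  shows "(LINT x|lborel. K (Complex x y)) = (LINT x|lborel. K (Complex x 0))"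
proof -
  obtain P where P: "\<And>z. z \<in> strip m \<Longrightarrow> (P has_field_derivative K z) (at z within strip m)"
    using holomorphic_convex_primitive'[OF convex_strip open_strip K] by blast
  have P': "(P has_field_derivative K z) (at z)" if "z \<in> strip m" for z
    using P[OF that] that by (simp add: at_within_open[OF _ open_strip])
  have FTC: "(LINT x|lborel. indicator {- real n..real n} x *\<^sub>R K (Complex x v)) = P (Complex n v) - P (Complex (- n) v)"
    if v: "\<bar>v\<bar> < m" for n v
  proof (rule integral_FTC_atLeastAtMost)
    have in_strip: "Complex x v \<in> strip m" for x using v by (simp add: strip_def)
    have "((\<lambda>x. P (Complex x v)) has_vector_derivative K (Complex x v)) (at x)" for x
    proof -
      define c where "c = Complex 0 v"
      have eq: "Complex x v = complex_of_real x + c" for x by (simp add: complex_eq_iff c_def)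
      have "((\<lambda>z. P (z + c)) has_field_derivative K (Complex x v)) (at (complex_of_real x))"
        using P'[OF in_strip[of x]] unfolding eq[of x] by (subst (asm) DERIV_shift)
      then show ?thesis
        unfolding eq by (rule has_vector_derivative_real_field)
    qed
    then show "((\<lambda>x. P (Complex x v)) has_vector_derivative K (Complex x v)) (at x within {- real n..real n})" for x
      by (rule has_vector_derivative_at_within)
    have "continuous_on UNIV (\<lambda>x. K (Complex x v))"
      using holomorphic_on_imp_continuous_on[OF K]
      by (rule continuous_on_compose2) (use in_strip in \<open>auto intro!: continuous_intros\<close>)
    then show "continuous_on {- real n..real n} (\<lambda>x. K (Complex x v))"
      by (rule continuous_on_subset) simp
  qed simp
  have side: "cmod (P (Complex x y) - P (Complex x 0)) \<le> b x * \<bar>y\<bar>" for x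
  proof -
    have seg: "z \<in> strip m \<and> \<bar>Im z\<bar> \<le> \<bar>y\<bar> \<and> Re z = x" if zs: "z \<in> closed_segment (Complex x y) (Complex x 0)" for z
    proof -
      obtain u where u: "0 \<le> u" "u \<le> 1" "z = (1 - u) *\<^sub>R Complex x y + u *\<^sub>R Complex x 0"
        using zs unfolding in_segment by blast
      have "\<bar>(1 - u) * y\<bar> \<le> 1 * \<bar>y\<bar>"
        unfolding abs_mult using u by (intro mult_right_mono) auto
      moreover have "Im z = (1 - u) * y" "Re z = x"
        by (simp_all add: u(3) algebra_simps)
      ultimately show ?thesis using y by (simp add: strip_def)
    qed
    have "cmod (P (Complex x y) - P (Complex x 0)) \<le> b x * cmod (Complex x y - Complex x 0)"
    proof (rule field_differentiable_bound)
      show "convex (closed_segment (Complex x y) (Complex x 0))" by (rule convex_closed_segment)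
      show "(P has_field_derivative K z) (at z within closed_segment (Complex x y) (Complex x 0))"
        if "z \<in> closed_segment (Complex x y) (Complex x 0)" for z
        by (rule has_field_derivative_at_within[OF P']) (use seg[OF that] in simp)
      show "cmod (K z) \<le> b x" if "z \<in> closed_segment (Complex x y) (Complex x 0)" for z
        using bound[of z] seg[OF that] by simp
    qed auto
    moreover have "cmod (Complex x y - Complex x 0) = \<bar>y\<bar>"
      by (simp add: cmod_def)
    ultimately show ?thesis by simp
  qed
  have "(\<lambda>n. (LINT x|lborel. indicator {- real n..real n} x *\<^sub>R K (Complex x y)) - (LINT x|lborel. indicator {- real n..real n} x *\<^sub>R K (Complex x 0))) \<longlonglongrightarrow> 0"
  proof (rule Lim_null_comparison, rule always_eventually, rule allI)
    show "(\<lambda>n. b (real n) * \<bar>y\<bar> + b (- real n) * \<bar>y\<bar>) \<longlonglongrightarrow> 0"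
      using tendsto_add[OF tendsto_mult_right[OF b(1), of "\<bar>y\<bar>"] tendsto_mult_right[OF b(2), of "\<bar>y\<bar>"]] by simp
    fix n
    have "(LINT x|lborel. indicator {- real n..real n} x *\<^sub>R K (Complex x y)) - (LINT x|lborel. indicator {- real n..real n} x *\<^sub>R K (Complex x 0))
      = (P (Complex n y) - P (Complex n 0)) - (P (Complex (- n) y) - P (Complex (- n) 0))"
      using y by (simp add: FTC)
    then show "norm ((LINT x|lborel. indicator {- real n..real n} x *\<^sub>R K (Complex x y)) - (LINT x|lborel. indicator {- real n..real n} x *\<^sub>R K (Complex x 0)))
      \<le> b (real n) * \<bar>y\<bar> + b (- real n) * \<bar>y\<bar>"
      using norm_triangle_ineq4[of "P (Complex n y) - P (Complex n 0)" "P (Complex (- n) y) - P (Complex (- n) 0)"]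
        side[of "real n"] side[of "- real n"] by simp
  qed
  moreover have "(\<lambda>n. (LINT x|lborel. indicator {- real n..real n} x *\<^sub>R K (Complex x y)) - (LINT x|lborel. indicator {- real n..real n} x *\<^sub>R K (Complex x 0)))
    \<longlonglongrightarrow> (LINT x|lborel. K (Complex x y)) - (LINT x|lborel. K (Complex x 0))"
    by (intro tendsto_diff tendsto_integral_symmetric_intervals int)
  ultimately have "0 = (LINT x|lborel. K (Complex x y)) - (LINT x|lborel. K (Complex x 0))"
    by (rule LIMSEQ_unique)
  then show ?thesis by simp
qed

lemma norm_gaussian_shift: "cmod (exp (- (z + c)\<^sup>2 / 2)) = exp ((Im (z + c))\<^sup>2 / 2) * exp (- (Re (z + c))\<^sup>2 / 2)"
  by (simp add: power2_eq_square field_simps flip: exp_add)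

text \<open>The Gaussian-tested transforms of both lines agree because the contour can be moved from one
  line to the other.\<close>

lemma fourier_horizontal_line:
  assumes g: "g holomorphic_on strip m" and y: "\<bar>y\<bar> < m"
    and bound: "\<And>z. z \<in> strip m \<Longrightarrow> cmod (g z) \<le> C"
    and G: "has_L2_fourier (\<lambda>x. g (Complex x 0)) G"
    and Gy: "has_L2_fourier (\<lambda>x. g (Complex x y)) Gy"
  shows "AE w in lborel. Gy w = G w * exp (- w * y)"
proof -
  have m0: "0 < m" using y by simp
  have G2: "G \<in> L2" "Gy \<in> L2" and g2: "(\<lambda>x. g (Complex x 0)) \<in> L2" "(\<lambda>x. g (Complex x y)) \<in> L2"
    using G Gy by (auto simp: has_L2_fourier_def)
  \<comment> \<open>The weight \<open>exp (- w * y)\<close> merely shifts the parameter of the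
    Gaussian, so the product of \<open>G\<close> with it need not be known to be in
    \<open>L2\<close>.\<close>
  have gw: "gaussian_wave z w * exp (- complex_of_real w * complex_of_real y) = gaussian_wave (z - \<i> * complex_of_real y) w" for z w
    unfolding gaussian_wave_def mult_exp_exp by (rule arg_cong[of _ _ exp]) (simp add: field_simps)
  have gwt: "gaussian_wave z w * iexp (t * w) = gaussian_wave (z - complex_of_real t) w" for z t w
    unfolding gaussian_wave_def mult_exp_exp by (rule arg_cong[of _ _ exp]) (simp add: field_simps)
  define H where "H = (\<lambda>w. (Gy w - G w * exp (- complex_of_real w * complex_of_real y)) * gaussian_wave 0 w)"
  have Heq: "H w = Gy w * gaussian_wave 0 w - G w * gaussian_wave (0 - \<i> * complex_of_real y) w" for w
    unfolding H_def gw[symmetric] by (simp add: algebra_simps)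
  have "AE w in lborel. H w = 0"
  proof (rule L1_fourier_unique)
    show "integrable lborel H"
      unfolding Heq using G2 by (intro Bochner_Integration.integrable_diff L2_mult_integrable gaussian_wave_L2)
    fix t
    \<comment> \<open>The one entire Gaussian factor serves both tests: on the line at height
      \<open>y\<close> it is the real Gaussian centred at \<open>t\<close>, on the real line it is
      the one with the additional shift by \<open>- \<i> * y\<close>.\<close>
    define K where "K = (\<lambda>z. g z * exp (- (z + (- complex_of_real t - \<i> * complex_of_real y))\<^sup>2 / 2))"
    have swap: "- (\<i> * complex_of_real y) - complex_of_real t = - complex_of_real t - \<i> * complex_of_real y"
      by simp
    have "H w * iexp (t * w) = Gy w * gaussian_wave (- complex_of_real t) w - G w * gaussian_wave (- complex_of_real t - \<i> * complex_of_real y) w" for w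
      using gwt[of 0 w t] gwt[of "- (\<i> * complex_of_real y)" w t, unfolded swap] by (simp add: Heq left_diff_distrib mult.assoc)
    then have "(LINT w|lborel. H w * iexp (t * w)) = (LINT w|lborel. Gy w * gaussian_wave (- complex_of_real t) w) - (LINT w|lborel. G w * gaussian_wave (- complex_of_real t - \<i> * complex_of_real y) w)"
      using G2 by (simp add: L2_mult_integrable gaussian_wave_L2)
    also have "(LINT w|lborel. Gy w * gaussian_wave (- complex_of_real t) w) = (LINT x|lborel. K (Complex x y))"
      unfolding has_L2_fourier_gaussian_wave[OF Gy] K_def
      by (intro Bochner_Integration.integral_cong refl arg_cong2[of _ _ _ _ "(*)"]) (simp add: Complex_eq)
    also have "(LINT w|lborel. G w * gaussian_wave (- complex_of_real t - \<i> * complex_of_real y) w) = (LINT x|lborel. K (Complex x 0))"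
      unfolding has_L2_fourier_gaussian_wave[OF G] K_def
      by (intro Bochner_Integration.integral_cong refl arg_cong2[of _ _ _ _ "(*)"]) (simp add: Complex_eq)
    also have "(LINT x|lborel. K (Complex x y)) = (LINT x|lborel. K (Complex x 0))"
    \<comment> \<open>Between the two lines |Im z - y| <= 2 |y|, and half the square of this bound
      is the exponent \<open>2 * y^2\<close>.\<close>
    proof (rule integral_strip_shift[where m=m and b="\<lambda>x. C * (exp (2 * y\<^sup>2) * exp (- (x - t)\<^sup>2 / 2))"])
      show "K holomorphic_on strip m" unfolding K_def by (intro holomorphic_intros g) auto
      show "\<bar>y\<bar> < m" by fact
      have d: "(\<lambda>n. exp (- (real n - t)\<^sup>2 / 2)) \<longlonglongrightarrow> 0" "(\<lambda>n. exp (- (- real n - t)\<^sup>2 / 2)) \<longlonglongrightarrow> 0"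
        by real_asymp+
      show "(\<lambda>n. C * (exp (2 * y\<^sup>2) * exp (- (real n - t)\<^sup>2 / 2))) \<longlonglongrightarrow> 0"
        "(\<lambda>n. C * (exp (2 * y\<^sup>2) * exp (- (- real n - t)\<^sup>2 / 2))) \<longlonglongrightarrow> 0"
        by (intro tendsto_mult_right_zero d)+
      show "cmod (K z) \<le> C * (exp (2 * y\<^sup>2) * exp (- (Re z - t)\<^sup>2 / 2))" if z: "\<bar>Im z\<bar> \<le> \<bar>y\<bar>" for z
        unfolding K_def norm_mult norm_gaussian_shift
      proof (intro mult_mono)
        show "cmod (g z) \<le> C" using bound[of z] z y by (simp add: strip_def)
        then show "0 \<le> C" using norm_ge_zero order_trans by blast
        have "\<bar>Im z - y\<bar> \<le> 2 * \<bar>y\<bar>" using z by linarith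
        then have "\<bar>Im z - y\<bar>\<^sup>2 \<le> (2 * \<bar>y\<bar>)\<^sup>2" by (rule power_mono) simp
        then show "exp ((Im (z + (- complex_of_real t - \<i> * complex_of_real y)))\<^sup>2 / 2) \<le> exp (2 * y\<^sup>2)"
          by (simp add: power_mult_distrib)
      qed auto
      have gs: "exp (- (Complex x v + (- complex_of_real t - \<i> * complex_of_real y))\<^sup>2 / 2) = exp (- (complex_of_real x + (\<i> * complex_of_real v - complex_of_real t - \<i> * complex_of_real y))\<^sup>2 / 2)" for x v
        by (simp add: Complex_eq algebra_simps)
      show "integrable lborel (\<lambda>x. K (Complex x 0))" "integrable lborel (\<lambda>x. K (Complex x y))"
        unfolding K_def gs by (intro L2_mult_integrable g2 gaussian_shift_L2)+
    qed
    finally show "(LINT w|lborel. H w * iexp (t * w)) = 0" by simp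
  qed
  then show ?thesis
    by eventually_elim (simp add: H_def gaussian_wave_def exp_of_real[symmetric])
qed

lemma L2_horizontal_line:
  assumes g: "g holomorphic_on strip m" and y: "\<bar>y\<bar> < m" and fin: "sqint (\<lambda>x. g (Complex x y)) < \<infinity>"
  shows "(\<lambda>x. g (Complex x y)) \<in> L2"
proof -
  have "continuous_on UNIV (\<lambda>x. g (Complex x y))"
    using holomorphic_on_imp_continuous_on[OF g]
    by (rule continuous_on_compose2) (use y in \<open>auto intro!: continuous_intros simp: strip_def\<close>)
  then show ?thesis using fin by (simp add: L2_iff borel_measurable_continuous_onI)
qed

lemma on_reals_Complex: "on_reals g = (\<lambda>x. g (Complex x 0))"
  by (simp add: on_reals_def complex_of_real_def)

text \<open>The even weight \<open>exp (2 * lam * \<bar>w\<bar>)\<close> is at most the sum of the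
  weights \<open>exp (- 2 * lam * w)\<close> and \<open>exp (2 * lam * w)\<close>, which is why one
  line on each side of the real axis is needed. As \<open>lam < m\<close>, both lie inside the
  strip.\<close>

lemma fourier_L2_weighted:
  assumes g: "g holomorphic_on strip m" and lam: "0 < lam" "lam < m"
    and bound: "\<And>z. z \<in> strip m \<Longrightarrow> cmod (g z) \<le> C"
    and fin: "\<And>y. \<bar>y\<bar> < m \<Longrightarrow> sqint (\<lambda>x. g (Complex x y)) < \<infinity>"
  shows "fourier_L2 (on_reals g) \<in> L2_weighted lam"
proof -
  have L2: "(\<lambda>x. g (Complex x y)) \<in> L2" if "\<bar>y\<bar> < m" for y
    using L2_horizontal_line[OF g that fin[OF that]] .
  \<comment> \<open>Representatives are chosen for each line separately, so they are related only
    almost everywhere; at height 0 the choice is literally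
    \<open>fourier_L2 (on_reals g)\<close>.\<close>
  define G where "G = (\<lambda>y. fourier_L2 (\<lambda>x. g (Complex x y)))"
  have G: "has_L2_fourier (\<lambda>x. g (Complex x y)) (G y)" if "\<bar>y\<bar> < m" for y
    unfolding G_def by (rule has_L2_fourier_fourier_L2[OF L2[OF that]])
  have G2: "G y \<in> L2" if "\<bar>y\<bar> < m" for y
    using G[OF that] by (simp add: has_L2_fourier_def)
  have [measurable]: "G 0 \<in> borel_measurable borel" "G lam \<in> borel_measurable borel" "G (- lam) \<in> borel_measurable borel"
    using G2[of 0] G2[of lam] G2[of "- lam"] lam by (simp_all add: L2_measurable)
  have eq: "AE w in lborel. G y w = G 0 w * exp (- w * y)" if "\<bar>y\<bar> < m" for y
    by (rule fourier_horizontal_line[OF g that bound G G]) (use that in auto)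
  have "AE w in lborel. (cmod (G 0 w))\<^sup>2 * exp (2 * lam * \<bar>w\<bar>) \<le> (cmod (G lam w))\<^sup>2 + (cmod (G (- lam) w))\<^sup>2"
  proof -
    have "AE w in lborel. G lam w = G 0 w * exp (- w * lam)" "AE w in lborel. G (- lam) w = G 0 w * exp (- w * (- lam))"
      using eq[of lam] eq[of "- lam"] lam by simp_all
    then show ?thesis
    proof eventually_elim
      fix w :: real
      assume *: "G lam w = G 0 w * exp (- w * lam)" "G (- lam) w = G 0 w * exp (- w * (- lam))"
      have sq: "(cmod (G lam w))\<^sup>2 = (cmod (G 0 w))\<^sup>2 * exp (2 * lam * (- w))"
        "(cmod (G (- lam) w))\<^sup>2 = (cmod (G 0 w))\<^sup>2 * exp (2 * lam * w)"
        unfolding * by (simp_all add: norm_mult power_mult_distrib power2_eq_square mult_ac flip: exp_add)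
      show "(cmod (G 0 w))\<^sup>2 * exp (2 * lam * \<bar>w\<bar>) \<le> (cmod (G lam w))\<^sup>2 + (cmod (G (- lam) w))\<^sup>2"
        unfolding sq by (cases "w \<ge> 0") simp_all
    qed
  qed
  then have "(\<integral>\<^sup>+ w. ennreal ((cmod (G 0 w))\<^sup>2 * exp (2 * lam * \<bar>w\<bar>)) \<partial>lborel)
    \<le> (\<integral>\<^sup>+ w. ennreal ((cmod (G lam w))\<^sup>2) + ennreal ((cmod (G (- lam) w))\<^sup>2) \<partial>lborel)"
    by (intro nn_integral_mono_AE) (auto elim!: eventually_mono simp flip: ennreal_plus intro!: ennreal_leI)
  also have "\<dots> = sqint (G lam) + sqint (G (- lam))"
    unfolding sqint_def by (rule nn_integral_add) measurable
  also have "\<dots> < \<infinity>"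
    using G2[of lam] G2[of "- lam"] lam by (simp add: L2_iff)
  finally have fin_int: "(\<integral>\<^sup>+ w. ennreal ((cmod (G 0 w))\<^sup>2 * exp (2 * lam * \<bar>w\<bar>)) \<partial>lborel) < \<infinity>" .
  have "fourier_L2 (on_reals g) = G 0" by (simp add: G_def on_reals_Complex)
  with fin_int show ?thesis by (simp add: L2_weighted_def)
qed

section \<open>The flipping operator\<close>

text \<open>Since \<open>a\<close> and \<open>cnj a\<close> have equal modulus, the rational factor
  has modulus |cnj a - z| / |a - z|; the numerator is at most |a - z| + 2 Im a and the denominator
  at least Im a - m. The exponential factor has exponent z (1/cnj a - 1/a) = 2 i z Im a / |a|^2,
  with real part -2 Im a Im z / |a|^2. Keeping \<open>m\<close> in the exponent leaves the room for
  strictness.\<close>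

lemma cmod_flip_op_le:
  assumes "0 \<le> m" "m < Im a" and z: "\<bar>Im z\<bar> \<le> m"
  shows "cmod (flip_op a f z) \<le> (1 + 2 * Im a / (Im a - m)) * exp (2 * Im a * m / (cmod a)\<^sup>2) * cmod (f z)"
proof -
  have a0: "a \<noteq> 0" and ia: "0 < Im a" and na: "0 < cmod a" using assms by auto
  have low: "Im a - m \<le> cmod (a - z)"
    using abs_Im_le_cmod[of "a - z"] z by simp
  have pos: "0 < Im a - m" using assms by simp
  have az: "a \<noteq> z" using low pos by auto
  have "a - cnj a = complex_of_real (2 * Im a) * \<i>"
    by (simp add: complex_diff_cnj)
  then have caa: "cmod (a - cnj a) = 2 * Im a"
    using ia by (simp only: norm_mult norm_of_real) simp
  have "cmod (1 - z / cnj a) = cmod (cnj a - z) / cmod a"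
    using a0 by (simp add: diff_divide_eq_iff norm_divide)
  moreover have "cmod (1 - z / a) = cmod (a - z) / cmod a"
    using a0 by (simp add: diff_divide_eq_iff norm_divide)
  ultimately have "cmod ((1 - z / cnj a) / (1 - z / a)) = cmod (cnj a - z) / cmod (a - z)"
    using a0 by (simp add: norm_divide)
  also have "\<dots> \<le> (cmod (a - z) + 2 * Im a) / cmod (a - z)"
    using norm_triangle_ineq4[of "a - z" "a - cnj a"] caa by (intro divide_right_mono) simp_all
  also have "\<dots> = 1 + 2 * Im a / cmod (a - z)"
    using az by (simp add: add_divide_distrib)
  also have "\<dots> \<le> 1 + 2 * Im a / (Im a - m)"
    using low pos ia by (intro add_left_mono divide_left_mono mult_pos_pos) linarith+
  finally have 1: "cmod ((1 - z / cnj a) / (1 - z / a)) \<le> 1 + 2 * Im a / (Im a - m)" .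
  have "z / cnj a - z / a = z * (a - cnj a) / (cnj a * a)"
    using a0 by (simp add: field_simps)
  also have "\<dots> = z * (complex_of_real (2 * Im a) * \<i>) / complex_of_real ((cmod a)\<^sup>2)"
  proof -
    have "cnj a * a = complex_of_real ((cmod a)\<^sup>2)"
      by (metis complex_norm_square mult.commute of_real_power)
    then show ?thesis by (simp only: complex_diff_cnj of_real_mult)
  qed
  finally have "Re (z / cnj a - z / a) = - (2 * Im a * Im z) / (cmod a)\<^sup>2"
    by simp
  also have "\<dots> \<le> 2 * Im a * m / (cmod a)\<^sup>2"
  proof (rule divide_right_mono)
    have "- Im z * (2 * Im a) \<le> m * (2 * Im a)" using z ia by (intro mult_right_mono) auto
    then show "- (2 * Im a * Im z) \<le> 2 * Im a * m" by (simp add: mult_ac)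
  qed simp
  finally have 2: "cmod (exp (z / cnj a) / exp (z / a)) \<le> exp (2 * Im a * m / (cmod a)\<^sup>2)"
    by (simp flip: exp_diff)
  show ?thesis
    unfolding flip_op_def norm_mult by (intro mult_mono 1 2) (use ia pos in auto)
qed

lemma flip_op_holomorphic:
  assumes "f holomorphic_on UNIV" "0 < Im a" "m \<le> Im a"
  shows "flip_op a f holomorphic_on strip m"
proof -
  have "1 - z / a \<noteq> 0" if "z \<in> strip m" for z
  proof
    assume "1 - z / a = 0"
    then have "z = a" using assms(2) by (auto simp: field_simps)
    then show False using that assms by (simp add: strip_def)
  qed
  moreover have "a \<noteq> 0" "cnj a \<noteq> 0" using assms(2) by auto
  ultimately show ?thesis
    unfolding flip_op_def
    by (intro holomorphic_intros holomorphic_on_subset[OF assms(1)]) auto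
qed

text \<open>The bound is evaluated at the edge height \<open>m\<close>, so that it is uniform in
  \<open>y\<close> and survives the supremum over all lines.\<close>

lemma sqint_flip_op_le:
  assumes f: "f \<in> PW L" and L: "0 \<le> L" and m: "0 \<le> m" "m < Im a" and y: "\<bar>y\<bar> \<le> m"
  shows "sqint (\<lambda>x. flip_op a f (Complex x y))
    \<le> ennreal (((1 + 2 * Im a / (Im a - m)) * exp (2 * Im a * m / (cmod a)\<^sup>2) * exp (L * m) * PW_norm f)\<^sup>2)"
proof -
  define D where "D = (1 + 2 * Im a / (Im a - m)) * exp (2 * Im a * m / (cmod a)\<^sup>2)"
  have D: "D \<ge> 0" using m by (simp add: D_def)
  have "f holomorphic_on UNIV" using f by (simp add: PW_def)
  then have "continuous_on UNIV (\<lambda>x. f (Complex x y))"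
    by (rule continuous_on_compose2[OF holomorphic_on_imp_continuous_on]) (auto intro!: continuous_intros)
  then have meas: "(\<lambda>x. f (Complex x y)) \<in> borel_measurable borel"
    by (rule borel_measurable_continuous_onI)
  have "sqint (\<lambda>x. flip_op a f (Complex x y)) \<le> sqint (\<lambda>x. complex_of_real D * f (Complex x y))"
  proof (rule sqint_mono)
    fix x
    have "cmod (flip_op a f (Complex x y)) \<le> D * cmod (f (Complex x y))"
      unfolding D_def by (rule cmod_flip_op_le[OF m]) (simp add: y)
    then show "cmod (flip_op a f (Complex x y)) \<le> cmod (complex_of_real D * f (Complex x y))"
      using D by (simp add: norm_mult)
  qed
  also have "\<dots> = ennreal (D\<^sup>2) * sqint (\<lambda>x. f (Complex x y))"
    by (simp add: sqint_cmult[OF meas])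
  also have "\<dots> \<le> ennreal (D\<^sup>2) * ennreal (exp (2 * L * \<bar>y\<bar>) * (PW_norm f)\<^sup>2)"
    by (intro mult_left_mono PW_sqint_le f) simp
  also have "\<dots> \<le> ennreal (D\<^sup>2) * ennreal (exp (2 * L * m) * (PW_norm f)\<^sup>2)"
    using y L by (intro mult_left_mono ennreal_leI mult_right_mono) (auto intro: mult_left_mono)
  also have "\<dots> = ennreal ((D * exp (L * m) * PW_norm f)\<^sup>2)"
  proof -
    have "exp (2 * L * m) = (exp (L * m))\<^sup>2"
      by (simp add: power2_eq_square mult.assoc flip: exp_add)
    then show ?thesis by (simp add: power_mult_distrib mult.assoc flip: ennreal_mult)
  qed
  finally show ?thesis by (simp add: D_def)
qed

lemma PW_norm_nonneg [simp]: "0 \<le> PW_norm f"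
  by (simp add: PW_norm_def)

lemma flip_op_H2_strip:
  assumes f: "f \<in> PW L" and L: "0 \<le> L" and lam: "0 \<le> lam" "lam < Im a"
  shows "flip_op a f \<in> H2_strip lam"
    "H2_strip_norm lam (flip_op a f)
      \<le> (1 + 2 * Im a / (Im a - lam)) * exp (2 * Im a * lam / (cmod a)\<^sup>2) * exp (L * lam) * PW_norm f"
proof -
  define C where "C = (1 + 2 * Im a / (Im a - lam)) * exp (2 * Im a * lam / (cmod a)\<^sup>2) * exp (L * lam) * PW_norm f"
  have C: "0 \<le> C" using lam by (simp add: C_def)
  have le: "H2_strip_sqnorm lam (flip_op a f) \<le> ennreal (C\<^sup>2)"
    unfolding H2_strip_sqnorm_def C_def sqint_def[symmetric]
    by (intro SUP_least sqint_flip_op_le f L lam) auto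
  have "f holomorphic_on UNIV" using f by (simp add: PW_def)
  then show "flip_op a f \<in> H2_strip lam"
    unfolding H2_strip_def using flip_op_holomorphic[of f a lam] lam le by (auto intro: le_less_trans)
  have "enn2real (H2_strip_sqnorm lam (flip_op a f)) \<le> C\<^sup>2"
    using enn2real_mono[OF le] by simp
  then have "H2_strip_norm lam (flip_op a f) \<le> sqrt (C\<^sup>2)"
    unfolding H2_strip_norm_def by (rule real_sqrt_le_mono)
  then show "H2_strip_norm lam (flip_op a f)
      \<le> (1 + 2 * Im a / (Im a - lam)) * exp (2 * Im a * lam / (cmod a)\<^sup>2) * exp (L * lam) * PW_norm f"
    using C by (simp add: C_def)
qed

lemma fourier_flip_op_weighted:
  assumes f: "f \<in> PW L" and L: "0 \<le> L" and lam: "0 < lam" "lam < Im a"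
  shows "fourier_L2 (on_reals (flip_op a f)) \<in> L2_weighted lam"
proof -
  \<comment> \<open>The midpoint exceeds \<open>lam\<close>, so the lines at height lam and -lam are
    interior, and is less than \<open>Im a\<close>, so the flipping factor stays bounded.\<close>
  define m where "m = (lam + Im a) / 2"
  have m: "lam < m" "m < Im a" "0 \<le> m" "0 < Im a" using lam by (simp_all add: m_def)
  have hol: "f holomorphic_on UNIV" using f by (simp add: PW_def)
  obtain B where B: "\<And>z. cmod (f z) \<le> B * exp (L * \<bar>Im z\<bar>)"
    using PW_bounded_on_strip[OF f] by blast
  have "cmod (f 0) \<le> B" using B[of 0] by simp
  then have B0: "0 \<le> B" by (rule order_trans[OF norm_ge_zero])
  define D where "D = (1 + 2 * Im a / (Im a - m)) * exp (2 * Im a * m / (cmod a)\<^sup>2)"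
  have D: "D \<ge> 0" using m by (simp add: D_def)
  show ?thesis
  proof (rule fourier_L2_weighted[where m=m and C="D * (B * exp (L * m))"])
    show "flip_op a f holomorphic_on strip m"
      using flip_op_holomorphic[OF hol] m by simp
    show "cmod (flip_op a f z) \<le> D * (B * exp (L * m))" if "z \<in> strip m" for z
    proof -
      have z: "\<bar>Im z\<bar> \<le> m" using that by (simp add: strip_def)
      have "cmod (f z) \<le> B * exp (L * m)"
        using B[of z] by (rule order_trans) (use z L B0 in \<open>auto intro!: mult_left_mono\<close>)
      then show ?thesis
        using cmod_flip_op_le[OF m(3,2) z, of f] D unfolding D_def[symmetric]
        by (meson mult_left_mono order_trans)
    qed
    show "sqint (\<lambda>x. flip_op a f (Complex x y)) < \<infinity>" if "\<bar>y\<bar> < m" for y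
      using sqint_flip_op_le[OF f L m(3,2), of y] that by (auto intro: le_less_trans)
  qed (use lam m in auto)
qed

theorem lemma3p1:
  fixes L lam :: real and a :: complex and f :: "complex \<Rightarrow> complex"
  assumes "L > 0"
    and "f \<in> PW L"
    and "Im a > 0"
    and "f a \<noteq> 0"
    and "0 < lam" and "lam < Im a"
  shows "bounded_operator (PW L) PW_norm (H2_strip lam) (H2_strip_norm lam) (flip_op a)
    \<and> H2_strip_norm lam (flip_op a f)
        < (1 + 2 * Im a / (Im a - lam)) * exp (2 * (Im a)\<^sup>2 / (cmod a)\<^sup>2)
            * exp (L * lam) * PW_norm f
    \<and> fourier_L2 (on_reals (flip_op a f)) \<in> L2_weighted lam"
proof (intro conjI)
  have L: "0 \<le> L" and lam: "0 \<le> lam" using assms by auto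
  show "bounded_operator (PW L) PW_norm (H2_strip lam) (H2_strip_norm lam) (flip_op a)"
    unfolding bounded_operator_def
  proof (intro conjI)
    show "\<forall>g\<in>PW L. flip_op a g \<in> H2_strip lam"
      using flip_op_H2_strip(1)[OF _ L lam] assms by blast
    show "\<forall>g\<in>PW L. \<forall>h\<in>PW L. \<forall>\<alpha> \<beta>. flip_op a (\<lambda>z. \<alpha> * g z + \<beta> * h z) = (\<lambda>z. \<alpha> * flip_op a g z + \<beta> * flip_op a h z)"
    proof -
      \<comment> \<open>The operator multiplies by a fixed function. Linearity holds at
        \<open>z = a\<close> as well, where division by zero gives this factor the value 0.\<close>
      have *: "c * (\<alpha> * u + \<beta> * v) = \<alpha> * (c * u) + \<beta> * (c * v)" for c u v \<alpha> \<beta> :: complex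
        by (simp add: algebra_simps)
      show ?thesis
        unfolding flip_op_def by (intro ballI allI ext *)
    qed
    show "\<exists>C. \<forall>g\<in>PW L. H2_strip_norm lam (flip_op a g) \<le> C * PW_norm g"
      using flip_op_H2_strip(2)[OF _ L lam] assms by blast
  qed
  \<comment> \<open>Here \<open>f a \<noteq> 0\<close> enters: it excludes the zero function, for
    which both sides of the strict inequality would be 0.\<close>
  have norm_pos: "0 < PW_norm f"
    using PW_norm_eq_0D[OF assms(2), of a] assms(4) PW_norm_nonneg[of f] by (auto simp: less_le)
  have "0 < cmod a" using assms(3) by auto
  then have "2 * Im a * lam / (cmod a)\<^sup>2 < 2 * (Im a)\<^sup>2 / (cmod a)\<^sup>2"
    using assms by (intro divide_strict_right_mono) (auto simp: power2_eq_square)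
  then have "(1 + 2 * Im a / (Im a - lam)) * exp (2 * Im a * lam / (cmod a)\<^sup>2) * exp (L * lam) * PW_norm f
    < (1 + 2 * Im a / (Im a - lam)) * exp (2 * (Im a)\<^sup>2 / (cmod a)\<^sup>2) * exp (L * lam) * PW_norm f"
    using norm_pos assms by (intro mult_strict_right_mono mult_strict_left_mono) (auto intro!: add_pos_pos)
  with flip_op_H2_strip(2)[OF assms(2) L lam assms(6)]
  show "H2_strip_norm lam (flip_op a f) < (1 + 2 * Im a / (Im a - lam)) * exp (2 * (Im a)\<^sup>2 / (cmod a)\<^sup>2) * exp (L * lam) * PW_norm f"
    by (rule le_less_trans)
  show "fourier_L2 (on_reals (flip_op a f)) \<in> L2_weighted lam"
    by (rule fourier_flip_op_weighted[OF assms(2) L assms(5,6)])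
qed

end
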